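(* Let $S^6$ carry the round metric $g_{can}$ and the octonionic almost complex structure $J_{can}$ (defined in the context), and let $\omega$ be the 2-form on $S^6$ given by $\omega(u,v)=g_{can}(J_{can}u,v)$. Then there is no integrable almost complex structure $J$ on $S^6$ that is $\omega$-compatible, i.e. that satisfies $\omega(Ju,Jv)=\omega(u,v)$ for all $y\in S^6$ and all $u,v\in T_yS^6$.
   Context: An almost complex structure on a smooth manifold $M$ is a smooth bundle endomorphism $J$ of $TM$ with $J^2=-1$. It is integrable if it is induced by the holomorphic coordinates of a complex manifold structure on $M$. In the definition of $\omega$-compatible, no positivity condition such as $\omega(u,Ju)>0$ is imposed. Definition of $G_2$. Let $V=\mathbb{R}\oplus\mathbb{C}^3\cong\mathbb{R}^7$ with orthonormal basis $e_1,\dots,e_7$, and let $S^6$ be the unit sphere in $V$, with the round metric $g_{can}$. On $V_{\mathbb{C}}=\mathbb{C}^7$ use the basis $e_1,F_1,F_2,F_3,\bar F_1,\bar F_2,\bar F_3$, where $F_1=\frac{e_2-ie_3}{2}$, $F_2=\frac{e_4-ie_5}{2}$, $F_3=\frac{e_6-ie_7}{2}$, to identify endomorphisms of $V_{\mathbb{C}}$ with matrices. For $a\in\mathbb{C}^3$ put $$[a]=\begin{pmatrix} 0 & a_3 & -a_2 \\ -a_3 & 0 & a_1 \\ a_2 & -a_1 & 0 \end{pmatrix},\qquad a^*=\bar a^t .$$ Let $$\mathfrak{g}_2=\left\{\begin{pmatrix} 0 & -ia^* & ia^t \\ -2ia & D & [\bar a] \\ 2i\bar a & [a] & \bar D \end{pmatrix}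 : a\in\mathbb{C}^3,\ D\in\mathfrak{su}(3)\right\}.$$ This is a Lie subalgebra of $\mathfrak{so}(V)$ (acting $\mathbb{C}$-linearly on $V_{\mathbb{C}}$). $G_2$ is the simply-connected Lie group with Lie algebra $\mathfrak{g}_2$; it is compact and embedded as a closed subgroup $G_2\subset SO(V)$. Let $x\colon G_2\to S^6$, $x(g)=g e_1$; this is a surjective submersion and a principal bundle for the right action of the stabilizer $SU(3)\subset G_2$ of $e_1$ ($A\in SU(3)$ being embedded as $\mathrm{diag}(1,A,\bar A)$). Let $\phi=g^{-1}dg\in\Omega^1(G_2;\mathfrak{g}_2)$ be the Maurer–Cartan form and let $\theta=(\theta^1,\theta^2,\theta^3)^t\in\Omega^1(G_2;\mathbb{C}^3)$ be its component corresponding to the parameter $a$ in the matrix above. Definition of $J_{can}$. For $y\in S^6$ and $g\in G_2$ with $x(g)=y$, the forms $\theta^i_g,\bar\theta^i_g$ vanish on $\ker dx_g$ and so descend to a basis of $T_y^*S^6\otimes\mathbb{C}$. The span of $\theta^1_g,\theta^2_g,\theta^3_g$ does not depend on the choice of $g$. $J_{can}$ is the almost complex structure on $S^6$ whose $(1,0)$-forms (complex linear forms $(T_yS^6,J_{can})\to\mathbb{C}$) at $y$ are spanned by $\theta^1_g,\theta^2_g,\theta^3_g$ and whose $(0,1)$-forms are spanned by $\bar\theta^1_g,\bar\theta^2_g,\bar\theta^3_g$. *)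

theory Defs
  imports "HOL-Analysis.Analysis"
begin

text \<open>
  Smooth means \<open>C\<^sup>\<infinity>\<close>.  A map on an arbitrary subset of a Euclidean space is smooth if it extends,
  near every point of that subset, to a smooth map on an open set.  For embedded submanifolds such
  as \<open>S\<^sup>6\<close> and \<open>TS\<^sup>6\<close> this is smoothness with respect to the submanifold structure.
\<close>

primrec Ck_on_open ::
    "nat \<Rightarrow> 'a::euclidean_space set \<Rightarrow> ('a \<Rightarrow> 'b::euclidean_space) \<Rightarrow> bool" where
  "Ck_on_open 0 U f \<longleftrightarrow> continuous_on U f"
| "Ck_on_open (Suc k) U f \<longleftrightarrow>
     f differentiable_on U \<and> (\<forall>v. Ck_on_open k U (\<lambda>x. frechet_derivative f (at x) v))"

definition smooth_map_on :: "'a::euclidean_space set \<Rightarrow> ('a \<Rightarrow> 'b::euclidean_space) \<Rightarrow> bool" where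
  "smooth_map_on S f \<longleftrightarrow>
     (\<forall>x\<in>S. \<exists>U F. open U \<and> x \<in> U \<and> (\<forall>k. Ck_on_open k U F) \<and> (\<forall>y\<in>S \<inter> U. F y = f y))"

definition S6 :: "(real^7) set" where
  "S6 = sphere 0 1"

definition tangent_S6 :: "real^7 \<Rightarrow> (real^7) set" where
  "tangent_S6 y = {v. v \<bullet> y = 0}"

definition TS6 :: "((real^7) \<times> (real^7)) set" where
  "TS6 = {(y, v). y \<in> S6 \<and> v \<in> tangent_S6 y}"

definition real_linear_on_tangent :: "real^7 \<Rightarrow> (real^7 \<Rightarrow> 'b::real_vector) \<Rightarrow> bool" where
  "real_linear_on_tangent y f \<longleftrightarrow>
     (\<forall>u\<in>tangent_S6 y. \<forall>v\<in>tangent_S6 y. f (u + v) = f u + f v) \<and>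
     (\<forall>c. \<forall>v\<in>tangent_S6 y. f (c *\<^sub>R v) = c *\<^sub>R f v)"

definition complex_structure_on_tangent :: "real^7 \<Rightarrow> (real^7 \<Rightarrow> real^7) \<Rightarrow> bool" where
  "complex_structure_on_tangent y j \<longleftrightarrow>
     real_linear_on_tangent y j \<and>
     (\<forall>v\<in>tangent_S6 y. j v \<in> tangent_S6 y \<and> j (j v) = - v)"

text \<open>
  A bundle endomorphism is a family \<open>J y\<close> of maps of the ambient space \<open>\<real>\<^sup>7\<close>, of which only the
  values on \<open>T\<^sub>yS\<^sup>6\<close> with \<open>y \<in> S\<^sup>6\<close> matter.
\<close>

definition almost_complex_structure :: "(real^7 \<Rightarrow> real^7 \<Rightarrow> real^7) \<Rightarrow> bool" where
  "almost_complex_structure J \<longleftrightarrow>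
     (\<forall>y\<in>S6. complex_structure_on_tangent y (J y)) \<and>
     smooth_map_on TS6 (\<lambda>(y, v). J y v)"

definition smooth_chart :: "(real^7) set \<Rightarrow> (real^7 \<Rightarrow> complex^3) \<Rightarrow> bool" where
  "smooth_chart U \<phi> \<longleftrightarrow>
     openin (top_of_set S6) U \<and> inj_on \<phi> U \<and> open (\<phi> ` U) \<and>
     smooth_map_on U \<phi> \<and> smooth_map_on (\<phi> ` U) (the_inv_into U \<phi>)"

definition holomorphic_map_on :: "(complex^3) set \<Rightarrow> (complex^3 \<Rightarrow> complex^3) \<Rightarrow> bool" where
  "holomorphic_map_on S f \<longleftrightarrow>
     (\<forall>z\<in>S. \<exists>D. (f has_derivative D) (at z) \<and> (\<forall>c v. D (c *s v) = c *s D v))"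

definition complex_atlas :: "((real^7) set \<times> (real^7 \<Rightarrow> complex^3)) set \<Rightarrow> bool" where
  "complex_atlas \<A> \<longleftrightarrow>
     (\<Union>(U, \<phi>)\<in>\<A>. U) = S6 \<and>
     (\<forall>(U, \<phi>)\<in>\<A>. smooth_chart U \<phi>) \<and>
     (\<forall>(U, \<phi>)\<in>\<A>. \<forall>(W, \<psi>)\<in>\<A>. holomorphic_map_on (\<phi> ` (U \<inter> W)) (\<psi> \<circ> the_inv_into U \<phi>))"

text \<open>
  \<open>J\<close> is induced by an atlas if the differential of every chart turns \<open>J\<close> into multiplication by
  \<open>\<i>\<close>.  The derivative \<open>D\<close> within \<open>S\<^sup>6\<close> is unique on \<open>T\<^sub>yS\<^sup>6\<close>, where it is the differential of \<open>\<phi>\<close>.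
\<close>

definition induced_by_atlas ::
    "((real^7) set \<times> (real^7 \<Rightarrow> complex^3)) set \<Rightarrow> (real^7 \<Rightarrow> real^7 \<Rightarrow> real^7) \<Rightarrow> bool" where
  "induced_by_atlas \<A> J \<longleftrightarrow>
     (\<forall>(U, \<phi>)\<in>\<A>. \<forall>y\<in>U. \<exists>D. (\<phi> has_derivative D) (at y within S6) \<and>
        (\<forall>v\<in>tangent_S6 y. D (J y v) = \<i> *s D v))"

definition integrable_acs :: "(real^7 \<Rightarrow> real^7 \<Rightarrow> real^7) \<Rightarrow> bool" where
  "integrable_acs J \<longleftrightarrow> (\<exists>\<A>. complex_atlas \<A> \<and> induced_by_atlas \<A> J)"

text \<open>In the index type \<open>7\<close> the numeral \<open>7\<close> is \<open>0\<close>, so the indices are \<open>1, \<dots>, 7\<close>.\<close>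

definition e1 :: "real^7" where
  "e1 = axis 1 1"

definition F_vec :: "7 \<Rightarrow> 7 \<Rightarrow> complex^7" where
  "F_vec k l = (1/2) *s (axis k 1 - \<i> *s axis l 1)"

definition F_bar_vec :: "7 \<Rightarrow> 7 \<Rightarrow> complex^7" where
  "F_bar_vec k l = (1/2) *s (axis k 1 + \<i> *s axis l 1)"

text \<open>The columns of \<open>frame\<close> are \<open>e\<^sub>1, F\<^sub>1, F\<^sub>2, F\<^sub>3\<close> and the conjugates of the \<open>F\<^sub>k\<close>.\<close>

definition frame :: "complex^7^7" where
  "frame = transpose (vector
     [axis 1 1, F_vec 2 3, F_vec 4 5, F_vec 6 7, F_bar_vec 2 3, F_bar_vec 4 5, F_bar_vec 6 7])"

definition complexify :: "real^7^7 \<Rightarrow> complex^7^7" where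
  "complexify A = (\<chi> i j. complex_of_real (A $ i $ j))"

definition su3 :: "(complex^3^3) set" where
  "su3 = {D. (\<forall>i j. cnj (D $ j $ i) = - D $ i $ j) \<and> trace D = 0}"

definition g2_matrix :: "complex^3 \<Rightarrow> complex^3^3 \<Rightarrow> complex^7^7" where
  "g2_matrix a D =
     (let a1 = a $ 1; a2 = a $ 2; a3 = a $ 3;
          b1 = cnj a1; b2 = cnj a2; b3 = cnj a3;
          d = (\<lambda>i j. D $ i $ j); d' = (\<lambda>i j. cnj (D $ i $ j))
      in vector
       [vector [0,           - \<i> * b1, - \<i> * b2, - \<i> * b3,  \<i> * a1, \<i> * a2, \<i> * a3],
        vector [- 2*\<i> * a1,  d 1 1,    d 1 2,    d 1 3,     0,      b3,     - b2],
        vector [- 2*\<i> * a2,  d 2 1,    d 2 2,    d 2 3,     - b3,   0,      b1],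
        vector [- 2*\<i> * a3,  d 3 1,    d 3 2,    d 3 3,     b2,     - b1,   0],
        vector [2*\<i> * b1,    0,        a3,       - a2,      d' 1 1, d' 1 2, d' 1 3],
        vector [2*\<i> * b2,    - a3,     0,        a1,        d' 2 1, d' 2 2, d' 2 3],
        vector [2*\<i> * b3,    a2,       - a1,     0,         d' 3 1, d' 3 2, d' 3 3]])"

text \<open>The real endomorphism \<open>A\<close> has matrix \<open>g2_matrix a D\<close> in the basis \<open>frame\<close>.\<close>

definition has_g2_params :: "real^7^7 \<Rightarrow> complex^3 \<Rightarrow> complex^3^3 \<Rightarrow> bool" where
  "has_g2_params A a D \<longleftrightarrow> D \<in> su3 \<and> complexify A ** frame = frame ** g2_matrix a D"

definition g2 :: "(real^7^7) set" where
  "g2 = {A. \<exists>a D. has_g2_params A a D}"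

definition matrix_exp :: "real^7^7 \<Rightarrow> real^7^7" where
  "matrix_exp A = (\<Sum>k. (1 / fact k) *\<^sub>R (((**) A ^^ k) (mat 1)))"

text \<open>
  The connected Lie subgroup of \<open>SO(7)\<close> with Lie algebra \<open>g2\<close>, i.e. the subgroup generated by the
  exponentials (it is closed under inverses because \<open>g2\<close> is closed under negation).
\<close>

inductive_set G2 :: "(real^7^7) set" where
  one: "mat 1 \<in> G2"
| step: "A \<in> g2 \<Longrightarrow> g \<in> G2 \<Longrightarrow> matrix_exp A ** g \<in> G2"

definition tangent_G2 :: "real^7^7 \<Rightarrow> (real^7^7) set" where
  "tangent_G2 g = {g ** A | A. A \<in> g2}"

definition maurer_cartan :: "real^7^7 \<Rightarrow> real^7^7 \<Rightarrow> real^7^7" where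
  "maurer_cartan g X = matrix_inv g ** X"

definition theta :: "real^7^7 \<Rightarrow> real^7^7 \<Rightarrow> complex^3" where
  "theta g X = (THE a. \<exists>D. has_g2_params (maurer_cartan g X) a D)"

text \<open>
  The form on \<open>T\<^sub>yS\<^sup>6\<close>, \<open>y = g e\<^sub>1\<close>, to which \<open>\<theta>\<^sub>g\<close> descends along the differential \<open>X \<mapsto> X e\<^sub>1\<close> of
  \<open>g \<mapsto> g e\<^sub>1\<close>.
\<close>

definition theta_desc :: "real^7^7 \<Rightarrow> real^7 \<Rightarrow> complex^3" where
  "theta_desc g v = (THE a. \<exists>X\<in>tangent_G2 g. X *v e1 = v \<and> theta g X = a)"

text \<open>
  The (1,0)-forms of \<open>j\<close> at \<open>y\<close> are the complex linear ones, and the (0,1)-forms the complex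
  antilinear ones; forms on \<open>T\<^sub>yS\<^sup>6\<close> are represented by functions on \<open>\<real>\<^sup>7\<close> and compared on \<open>T\<^sub>yS\<^sup>6\<close> only.
\<close>

definition J_can_at :: "real^7 \<Rightarrow> (real^7 \<Rightarrow> real^7) \<Rightarrow> bool" where
  "J_can_at y j \<longleftrightarrow>
     complex_structure_on_tangent y j \<and>
     (\<forall>g\<in>G2. g *v e1 = y \<longrightarrow>
       (\<forall>\<alpha> :: real^7 \<Rightarrow> complex. real_linear_on_tangent y \<alpha> \<longrightarrow>
          ((\<forall>v\<in>tangent_S6 y. \<alpha> (j v) = \<i> * \<alpha> v) \<longleftrightarrow>
           (\<exists>c :: complex^3. \<forall>v\<in>tangent_S6 y. \<alpha> v = (\<Sum>k\<in>UNIV. c $ k * theta_desc g v $ k))) \<and>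
          ((\<forall>v\<in>tangent_S6 y. \<alpha> (j v) = - \<i> * \<alpha> v) \<longleftrightarrow>
           (\<exists>c :: complex^3. \<forall>v\<in>tangent_S6 y. \<alpha> v = (\<Sum>k\<in>UNIV. c $ k * cnj (theta_desc g v $ k))))))"

text \<open>The choice is unique on \<open>T\<^sub>yS\<^sup>6\<close>; off \<open>T\<^sub>yS\<^sup>6\<close> it is arbitrary.\<close>

definition J_can :: "real^7 \<Rightarrow> real^7 \<Rightarrow> real^7" where
  "J_can y = (SOME j. J_can_at y j)"

definition omega :: "real^7 \<Rightarrow> real^7 \<Rightarrow> real^7 \<Rightarrow> real" where
  "omega y u v = J_can y u \<bullet> v"

definition omega_compatible :: "(real^7 \<Rightarrow> real^7 \<Rightarrow> real^7) \<Rightarrow> bool" where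
  "omega_compatible J \<longleftrightarrow>
     (\<forall>y\<in>S6. \<forall>u\<in>tangent_S6 y. \<forall>v\<in>tangent_S6 y. omega y (J y u) (J y v) = omega y u v)"

end

theory Submission
  imports Defs "HOL-Homology.Brouwer_Degree"
begin

text \<open>
  Let \<open>K\<close> be the octonionic almost complex structure.  It is the cross product \<open>K v = y \<times> v\<close> on
  \<open>T\<^sub>yS\<^sup>6\<close>, so \<open>\<omega>\<^sub>y(u, v) = \<phi>(y, u, v)\<close> for the octonionic 3-form \<open>\<phi>(u, v, w) = (u \<times> v) \<bullet> w\<close> of \<open>\<real>\<^sup>7\<close>
  (\<open>J_can_eq_cross7\<close>), and \<open>d\<omega>\<close> is three times the restriction of \<open>\<phi>\<close> to \<open>S\<^sup>6\<close>.  Suppose that \<open>J\<close>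
  is integrable and \<open>\<omega>\<close>-compatible.

  Compatibility says that \<open>\<omega>\<close> has type (1,1) for \<open>J\<close>.  Since \<open>J\<close> is integrable, \<open>d\<omega>\<close> has
  no component of type (3,0) or (0,3), which is a pointwise identity between \<open>\<phi>\<close> and \<open>J\<close> on each tangent
  space (\<open>integrable_type_identity\<close>).

  On one tangent space \<open>\<omega>(u, J v)\<close> is a symmetric form, and diagonalizing it gives a \<open>K\<close>-unitary basis
  \<open>u\<^sub>1, u\<^sub>2, u\<^sub>3\<close> with \<open>J u\<^sub>i = l\<^sub>i K u\<^sub>i\<close> and real \<open>l\<^sub>i \<noteq> 0\<close> (\<open>exists_eigenbasis\<close>).  If the \<open>l\<^sub>i\<close> had
  one sign, the pointwise identity would force \<open>\<phi>(u\<^sub>1, u\<^sub>2, u\<^sub>3) = \<phi>(K u\<^sub>1, u\<^sub>2, u\<^sub>3) = 0\<close> and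
  hence \<open>u\<^sub>1 \<times> u\<^sub>2 = 0\<close>, which is absurd (\<open>signs_differ\<close>).  This settles the case in which
  \<open>\<omega>(u, J u)\<close> is definite.

  So at every point one of the signs occurs exactly once.  The \<open>K\<close>-complex line spanned by the
  corresponding \<open>u\<^sub>i\<close> does not depend on the basis, and the vectors \<open>u\<^sub>i\<close> that can occur in this role form a
  compact set (\<open>minority_line\<close>, \<open>compact_minority_set\<close>).  Hence these lines form a complex line subbundle of
  \<open>TS\<^sup>6\<close>.  A
  complex line bundle over \<open>S\<^sup>6\<close> is trivial: sections over the two hemispheres differ on the equator \<open>S\<^sup>5\<close>
  by a map to \<open>\<complex> - {0}\<close>, which has a logarithm because \<open>S\<^sup>5\<close> is simply connected (\<open>section_exists\<close>).
  A nonvanishing section is a nonvanishing tangent vector field on \<open>S\<^sup>6\<close>, and there is none since the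
  antipodal map of an even-dimensional sphere is not homotopic to the identity (\<open>hairy_ball_S6\<close>).
\<close>

section \<open>The cross product on seven-space\<close>

lemma exhaust_7:
  fixes x :: 7
  shows "x = 1 \<or> x = 2 \<or> x = 3 \<or> x = 4 \<or> x = 5 \<or> x = 6 \<or> x = 7"
proof (induct x)
  case (of_int z)
  then have "z = 0 \<or> z = 1 \<or> z = 2 \<or> z = 3 \<or> z = 4 \<or> z = 5 \<or> z = 6" by auto
  then show ?case by auto
qed

lemma forall_7:
  "(\<forall>i::7. P i) \<longleftrightarrow> P 1 \<and> P 2 \<and> P 3 \<and> P 4 \<and> P 5 \<and> P 6 \<and> P 7"
  by (metis exhaust_7)

lemma UNIV_7: "UNIV = {1, 2, 3, 4, 5, 6, 7::7}"
  using exhaust_7 by auto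

lemma sum_7: "sum f (UNIV::7 set) = f 1 + f 2 + f 3 + f 4 + f 5 + f 6 + f 7"
  unfolding UNIV_7 by (simp add: ac_simps)

lemma vector_7 [simp]:
  "(vector [a,b,c,d,e,f,g] ::('a::zero)^7)$1 = a"
  "(vector [a,b,c,d,e,f,g] ::('a::zero)^7)$2 = b"
  "(vector [a,b,c,d,e,f,g] ::('a::zero)^7)$3 = c"
  "(vector [a,b,c,d,e,f,g] ::('a::zero)^7)$4 = d"
  "(vector [a,b,c,d,e,f,g] ::('a::zero)^7)$5 = e"
  "(vector [a,b,c,d,e,f,g] ::('a::zero)^7)$6 = f"
  "(vector [a,b,c,d,e,f,g] ::('a::zero)^7)$7 = g"
  unfolding vector_def by simp_all

lemma inner_7: "(u::real^7) \<bullet> v = u$1 * v$1 + u$2 * v$2 + u$3 * v$3 + u$4 * v$4 + u$5 * v$5 + u$6 * v$6 + u$7 * v$7"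
  by (simp add: inner_vec_def sum_7)

text \<open>
  The cross product of imaginary octonions.  The signs are those of the 3-form
  \<open>123 + 145 + 167 + 246 - 257 - 347 - 356\<close>, which spans the 3-forms annihilated by \<open>g2\<close>; its own sign
  is chosen so that \<open>e\<^sub>1 \<times> _\<close> is multiplication by \<open>\<i>\<close> on the forms \<open>\<theta>\<close>.
\<close>

definition cross7 :: "real^7 \<Rightarrow> real^7 \<Rightarrow> real^7" where
  "cross7 u v = vector
    [u$2 * v$3 - u$3 * v$2 + u$4 * v$5 - u$5 * v$4 + u$6 * v$7 - u$7 * v$6,
     u$3 * v$1 - u$1 * v$3 + u$4 * v$6 - u$6 * v$4 - u$5 * v$7 + u$7 * v$5,
     u$1 * v$2 - u$2 * v$1 - u$4 * v$7 + u$7 * v$4 - u$5 * v$6 + u$6 * v$5,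
     u$5 * v$1 - u$1 * v$5 + u$6 * v$2 - u$2 * v$6 - u$7 * v$3 + u$3 * v$7,
     u$1 * v$4 - u$4 * v$1 - u$7 * v$2 + u$2 * v$7 - u$6 * v$3 + u$3 * v$6,
     u$7 * v$1 - u$1 * v$7 + u$2 * v$4 - u$4 * v$2 - u$3 * v$5 + u$5 * v$3,
     u$1 * v$6 - u$6 * v$1 - u$2 * v$5 + u$5 * v$2 - u$3 * v$4 + u$4 * v$3]"

lemma cross7_nth:
  "cross7 u v $ 1 = u$2 * v$3 - u$3 * v$2 + u$4 * v$5 - u$5 * v$4 + u$6 * v$7 - u$7 * v$6"
  "cross7 u v $ 2 = u$3 * v$1 - u$1 * v$3 + u$4 * v$6 - u$6 * v$4 - u$5 * v$7 + u$7 * v$5"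
  "cross7 u v $ 3 = u$1 * v$2 - u$2 * v$1 - u$4 * v$7 + u$7 * v$4 - u$5 * v$6 + u$6 * v$5"
  "cross7 u v $ 4 = u$5 * v$1 - u$1 * v$5 + u$6 * v$2 - u$2 * v$6 - u$7 * v$3 + u$3 * v$7"
  "cross7 u v $ 5 = u$1 * v$4 - u$4 * v$1 - u$7 * v$2 + u$2 * v$7 - u$6 * v$3 + u$3 * v$6"
  "cross7 u v $ 6 = u$7 * v$1 - u$1 * v$7 + u$2 * v$4 - u$4 * v$2 - u$3 * v$5 + u$5 * v$3"
  "cross7 u v $ 7 = u$1 * v$6 - u$6 * v$1 - u$2 * v$5 + u$5 * v$2 - u$3 * v$4 + u$4 * v$3"
  by (simp_all only: cross7_def vector_7)

lemma bilinear_cross7: "bilinear cross7"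
  by (simp add: bilinear_def linear_iff vec_eq_iff forall_7 cross7_nth algebra_simps)

lemma bounded_bilinear_cross7: "bounded_bilinear cross7"
  using bilinear_cross7 by (simp add: bilinear_conv_bounded_bilinear)

interpretation cross7: bounded_bilinear cross7
  by (rule bounded_bilinear_cross7)

lemma cross7_skew: "cross7 v u = - cross7 u v"
  by (simp add: vec_eq_iff forall_7 cross7_nth)

lemma inner_cross7_skew: "cross7 u v \<bullet> w = - (v \<bullet> cross7 u w)"
  by (simp add: inner_7 cross7_nth algebra_simps)

lemma inner_cross7_cyclic: "cross7 u v \<bullet> w = cross7 v w \<bullet> u"
  by (simp add: inner_7 cross7_nth algebra_simps)

lemma cross7_cross7: "cross7 u (cross7 u v) = (u \<bullet> v) *\<^sub>R u - (u \<bullet> u) *\<^sub>R v"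
  by (simp add: vec_eq_iff forall_7 inner_7 cross7_nth algebra_simps)

lemma cross7_cross7_polarized:
  "cross7 x (cross7 y v) + cross7 y (cross7 x v) =
     (x \<bullet> v) *\<^sub>R y + (y \<bullet> v) *\<^sub>R x - (2 * (x \<bullet> y)) *\<^sub>R v"
  by (simp add: vec_eq_iff forall_7 inner_7 cross7_nth algebra_simps)

lemma norm_cross7: "cross7 u v \<bullet> cross7 u v = (u \<bullet> u) * (v \<bullet> v) - (u \<bullet> v)\<^sup>2"
  by (simp add: inner_7 cross7_nth algebra_simps power2_eq_square)

lemma inner_cross7_left [simp]: "u \<bullet> cross7 u v = 0" "cross7 u v \<bullet> u = 0"
  by (simp_all add: inner_7 cross7_nth algebra_simps)

lemma inner_cross7_right [simp]: "v \<bullet> cross7 u v = 0" "cross7 u v \<bullet> v = 0"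
  by (simp_all add: inner_7 cross7_nth algebra_simps)

lemma inner_cross7_swap: "u \<bullet> cross7 y v = - (v \<bullet> cross7 y u)"
  by (simp add: inner_7 cross7_nth algebra_simps)

text \<open>
  On \<open>T\<^sub>yS\<^sup>6\<close> the 3-form \<open>(u \<times> v) \<bullet> w\<close> is the real part of a form that is complex trilinear for \<open>y \<times> _\<close>,
  so the complex structure may be moved from one argument to another.
\<close>

lemma cross7_type:
  assumes "u \<bullet> y = 0" "v \<bullet> y = 0" "w \<bullet> y = 0"
  shows "cross7 (cross7 y u) v \<bullet> w = cross7 u (cross7 y v) \<bullet> w"
proof -
  have a: "cross7 v (cross7 y u) \<bullet> w = - (cross7 y (cross7 v u) \<bullet> w)"
    using arg_cong[OF cross7_cross7_polarized[of v y u], of "\<lambda>x. x \<bullet> w"] assms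
    by (simp add: inner_add_left inner_diff_left inner_commute[of y])
  have b: "cross7 u (cross7 y v) \<bullet> w = - (cross7 y (cross7 u v) \<bullet> w)"
    using arg_cong[OF cross7_cross7_polarized[of u y v], of "\<lambda>x. x \<bullet> w"] assms
    by (simp add: inner_add_left inner_diff_left inner_commute[of y])
  show ?thesis
    using a b by (simp add: cross7_skew[of v] cross7_skew[of v u] cross7.minus_right)
qed

section \<open>The Lie algebra of infinitesimal automorphisms\<close>

lemma frame_nth:
  "frame $ i $ 1 = (if i = 1 then 1 else 0)"
  "frame $ i $ 2 = (if i = 2 then 1/2 else if i = 3 then - \<i>/2 else 0)"
  "frame $ i $ 3 = (if i = 4 then 1/2 else if i = 5 then - \<i>/2 else 0)"
  "frame $ i $ 4 = (if i = 6 then 1/2 else if i = 7 then - \<i>/2 else 0)"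
  "frame $ i $ 5 = (if i = 2 then 1/2 else if i = 3 then \<i>/2 else 0)"
  "frame $ i $ 6 = (if i = 4 then 1/2 else if i = 5 then \<i>/2 else 0)"
  "frame $ i $ 7 = (if i = 6 then 1/2 else if i = 7 then \<i>/2 else 0)"
  by (simp_all add: frame_def transpose_def F_vec_def F_bar_vec_def axis_def)

text \<open>
  In both products with \<open>frame\<close> each entry involves at most two entries of the other factor; the next two lemmas
  turn the matrix equation that defines \<open>has_g2_params\<close> into scalar equations.
\<close>

lemma mult_frame_nth:
  "(X ** frame) $ i $ 1 = X $ i $ 1"
  "(X ** frame) $ i $ 2 = (X $ i $ 2 - \<i> * X $ i $ 3) / 2"
  "(X ** frame) $ i $ 3 = (X $ i $ 4 - \<i> * X $ i $ 5) / 2"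
  "(X ** frame) $ i $ 4 = (X $ i $ 6 - \<i> * X $ i $ 7) / 2"
  "(X ** frame) $ i $ 5 = (X $ i $ 2 + \<i> * X $ i $ 3) / 2"
  "(X ** frame) $ i $ 6 = (X $ i $ 4 + \<i> * X $ i $ 5) / 2"
  "(X ** frame) $ i $ 7 = (X $ i $ 6 + \<i> * X $ i $ 7) / 2"
  by (simp_all add: matrix_matrix_mult_def sum_7 frame_nth field_simps)

lemma frame_mult_nth:
  "(frame ** Y) $ 1 $ j = Y $ 1 $ j"
  "(frame ** Y) $ 2 $ j = (Y $ 2 $ j + Y $ 5 $ j) / 2"
  "(frame ** Y) $ 3 $ j = \<i> * (Y $ 5 $ j - Y $ 2 $ j) / 2"
  "(frame ** Y) $ 4 $ j = (Y $ 3 $ j + Y $ 6 $ j) / 2"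
  "(frame ** Y) $ 5 $ j = \<i> * (Y $ 6 $ j - Y $ 3 $ j) / 2"
  "(frame ** Y) $ 6 $ j = (Y $ 4 $ j + Y $ 7 $ j) / 2"
  "(frame ** Y) $ 7 $ j = \<i> * (Y $ 7 $ j - Y $ 4 $ j) / 2"
  by (simp_all add: matrix_matrix_mult_def sum_7 frame_nth field_simps)

lemma g2_params_equations:
  assumes "has_g2_params A a D"
  shows "(complexify A ** frame) $ i $ j = (frame ** g2_matrix a D) $ i $ j"
  using assms by (simp add: has_g2_params_def)

text \<open>
  The tangent vector at \<open>e\<^sub>1\<close> on which \<open>\<theta>\<close> takes the value \<open>a\<close>.
\<close>

definition first_column :: "complex^3 \<Rightarrow> real^7" where
  "first_column a = vector [0, 2 * Im (a$1), - 2 * Re (a$1), 2 * Im (a$2), - 2 * Re (a$2), 2 * Im (a$3), - 2 * Re (a$3)]"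

lemma first_column_nth:
  "first_column a $ 1 = 0" "first_column a $ 2 = 2 * Im (a$1)" "first_column a $ 3 = - 2 * Re (a$1)"
  "first_column a $ 4 = 2 * Im (a$2)" "first_column a $ 5 = - 2 * Re (a$2)"
  "first_column a $ 6 = 2 * Im (a$3)" "first_column a $ 7 = - 2 * Re (a$3)"
  by (simp_all only: first_column_def vector_7)

lemma g2_column_1:
  assumes "has_g2_params A a D"
  shows "A *v e1 = first_column a"
proof -
  have "A *v e1 = (\<chi> i. A $ i $ 1)"
    by (simp add: vec_eq_iff e1_def matrix_vector_mult_def axis_def if_distrib cong: if_cong)
  moreover have "\<forall>i. A $ i $ 1 = first_column a $ i"
    unfolding forall_7 first_column_nth
    using g2_params_equations[OF assms, of 1 1] g2_params_equations[OF assms, of 2 1]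
      g2_params_equations[OF assms, of 3 1] g2_params_equations[OF assms, of 4 1]
      g2_params_equations[OF assms, of 5 1] g2_params_equations[OF assms, of 6 1]
      g2_params_equations[OF assms, of 7 1]
    unfolding mult_frame_nth frame_mult_nth
    by (simp add: complexify_def g2_matrix_def Let_def complex_eq_iff)
  ultimately show ?thesis
    by (simp add: vec_eq_iff)
qed

text \<open>
  The first 28 equations are skew-symmetry.  The other seven say that \<open>A\<close> is orthogonal to the seven
  skew matrices \<open>v \<mapsto> e\<^sub>k \<times> v\<close>; together they cut the 14-dimensional \<open>g2\<close> out of the 21-dimensional \<open>so(7)\<close>.
\<close>

lemma g2_entries:
  assumes A: "has_g2_params A a D"
  shows "A$1$1 = 0" "A$2$2 = 0" "A$3$3 = 0" "A$4$4 = 0" "A$5$5 = 0" "A$6$6 = 0" "A$7$7 = 0"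
    "A$2$1 = - A$1$2" "A$3$1 = - A$1$3" "A$4$1 = - A$1$4" "A$5$1 = - A$1$5" "A$6$1 = - A$1$6" "A$7$1 = - A$1$7"
    "A$3$2 = - A$2$3" "A$4$2 = - A$2$4" "A$5$2 = - A$2$5" "A$6$2 = - A$2$6" "A$7$2 = - A$2$7"
    "A$4$3 = - A$3$4" "A$5$3 = - A$3$5" "A$6$3 = - A$3$6" "A$7$3 = - A$3$7"
    "A$5$4 = - A$4$5" "A$6$4 = - A$4$6" "A$7$4 = - A$4$7"
    "A$6$5 = - A$5$6" "A$7$5 = - A$5$7" "A$7$6 = - A$6$7"
    "A$6$7 = - A$2$3 - A$4$5" "A$5$7 = A$4$6 - A$1$3" "A$5$6 = A$1$2 - A$4$7"
    "A$3$7 = A$1$5 + A$2$6" "A$3$6 = - A$2$7 - A$1$4" "A$3$5 = A$2$4 - A$1$7" "A$3$4 = A$1$6 - A$2$5"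
proof -
  have eq: "\<forall>i. (complexify A ** frame) $ i $ j = (frame ** g2_matrix a D) $ i $ j" for j
    using g2_params_equations[OF A] by blast
  note c1 = eq[of 1, unfolded forall_7 mult_frame_nth frame_mult_nth]
  note c2 = eq[of 2, unfolded forall_7 mult_frame_nth frame_mult_nth]
  note c3 = eq[of 3, unfolded forall_7 mult_frame_nth frame_mult_nth]
  note c4 = eq[of 4, unfolded forall_7 mult_frame_nth frame_mult_nth]
  note simps = complexify_def g2_matrix_def Let_def complex_eq_iff
  note C1 = c1[simplified simps, simplified] and C2 = c2[simplified simps, simplified]
    and C3 = c3[simplified simps, simplified] and C4 = c4[simplified simps, simplified]
  have su: "\<forall>i j. cnj (D $ j $ i) = - D $ i $ j" "D$1$1 + D$2$2 + D$3$3 = 0"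
    using A by (auto simp: has_g2_params_def su3_def trace_def sum_3)
  note S = su[unfolded forall_3 complex_eq_iff, simplified]
  show "A$1$1 = 0" "A$2$2 = 0" "A$3$3 = 0" "A$4$4 = 0" "A$5$5 = 0" "A$6$6 = 0" "A$7$7 = 0"
    "A$2$1 = - A$1$2" "A$3$1 = - A$1$3" "A$4$1 = - A$1$4" "A$5$1 = - A$1$5" "A$6$1 = - A$1$6" "A$7$1 = - A$1$7"
    "A$3$2 = - A$2$3" "A$4$2 = - A$2$4" "A$5$2 = - A$2$5" "A$6$2 = - A$2$6" "A$7$2 = - A$2$7"
    "A$4$3 = - A$3$4" "A$5$3 = - A$3$5" "A$6$3 = - A$3$6" "A$7$3 = - A$3$7"
    "A$5$4 = - A$4$5" "A$6$4 = - A$4$6" "A$7$4 = - A$4$7"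
    "A$6$5 = - A$5$6" "A$7$5 = - A$5$7" "A$7$6 = - A$6$7"
    "A$6$7 = - A$2$3 - A$4$5" "A$5$7 = A$4$6 - A$1$3" "A$5$6 = A$1$2 - A$4$7"
    "A$3$7 = A$1$5 + A$2$6" "A$3$6 = - A$2$7 - A$1$4" "A$3$5 = A$2$4 - A$1$7" "A$3$4 = A$1$6 - A$2$5"
    using C1 C2 C3 C4 S by (elim conjE; linarith)+
qed

lemma mult_vec_7: "((A::real^7^7) *v u) $ i =
   A$i$1 * u$1 + A$i$2 * u$2 + A$i$3 * u$3 + A$i$4 * u$4 + A$i$5 * u$5 + A$i$6 * u$6 + A$i$7 * u$7"
  by (simp add: matrix_vector_mult_def sum_7)

lemma g2_derivation_cross7:
  assumes "A \<in> g2"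
  shows "A *v cross7 u v = cross7 (A *v u) v + cross7 u (A *v v)"
proof -
  obtain a D where "has_g2_params A a D"
    using assms by (auto simp: g2_def)
  note e = g2_entries[OF this]
  show ?thesis
    unfolding vec_eq_iff forall_7 vector_add_component cross7_nth mult_vec_7 e
    by (simp add: algebra_simps)
qed

lemma g2_derivation_inner:
  assumes "A \<in> g2"
  shows "(A *v u) \<bullet> v + u \<bullet> (A *v v) = 0"
proof -
  obtain a D where "has_g2_params A a D"
    using assms by (auto simp: g2_def)
  note e = g2_entries[OF this]
  show ?thesis
    unfolding inner_7 mult_vec_7 e by (simp add: algebra_simps)
qed

text \<open>
  The real form of \<open>g2_matrix a 0\<close>.
\<close>

definition g2_rep :: "complex^3 \<Rightarrow> real^7^7" where
  "g2_rep a = (let p1 = Re (a$1); q1 = Im (a$1); p2 = Re (a$2); q2 = Im (a$2); p3 = Re (a$3); q3 = Im (a$3) in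
    vector
     [vector [0, - 2*q1, 2*p1, - 2*q2, 2*p2, - 2*q3, 2*p3],
      vector [2*q1, 0, 0, p3, - q3, - p2, q2],
      vector [- 2*p1, 0, 0, - q3, - p3, q2, p2],
      vector [2*q2, - p3, q3, 0, 0, p1, - q1],
      vector [- 2*p2, q3, p3, 0, 0, - q1, - p1],
      vector [2*q3, p2, - q2, - p1, q1, 0, 0],
      vector [- 2*p3, - q2, - p2, q1, p1, 0, 0]])"

lemma g2_rep_params: "has_g2_params (g2_rep a) a 0"
proof -
  have "complexify (g2_rep a) ** frame = frame ** g2_matrix a 0"
    unfolding vec_eq_iff[of "_ :: complex^7^7"] vec_eq_iff[of "_ :: complex^7"] forall_7 mult_frame_nth frame_mult_nth
    by (simp add: complexify_def g2_matrix_def g2_rep_def Let_def complex_eq_iff)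
  then show ?thesis
    by (simp add: has_g2_params_def su3_def trace_def)
qed

section \<open>Exponentials, the group, and the canonical structure\<close>

definition exp_term :: "('a::real_vector \<Rightarrow> 'a) \<Rightarrow> 'a \<Rightarrow> nat \<Rightarrow> 'a" where
  "exp_term T x k = (1 / fact k) *\<^sub>R (T ^^ k) x"

lemma summable_exp_term:
  fixes T :: "'a::real_normed_vector \<Rightarrow> 'a"
  assumes "bounded_linear T"
  shows "summable (\<lambda>k. norm (exp_term T x k))"
proof (rule summable_comparison_test)
  have pow: "norm ((T ^^ k) x) \<le> onorm T ^ k * norm x" for k
  proof (induction k)
    case (Suc k)
    have "norm ((T ^^ Suc k) x) \<le> onorm T * norm ((T ^^ k) x)"
      using onorm[OF assms] by simp
    also have "\<dots> \<le> onorm T * (onorm T ^ k * norm x)"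
      using Suc onorm_pos_le[OF assms] by (rule mult_left_mono)
    finally show ?case by simp
  qed simp
  have "norm (norm (exp_term T x k)) \<le> inverse (fact k) * onorm T ^ k * norm x" for k
    using pow[of k] by (simp add: exp_term_def divide_simps)
  then show "\<exists>N. \<forall>k\<ge>N. norm (norm (exp_term T x k)) \<le> inverse (fact k) * onorm T ^ k * norm x"
    by blast
  show "summable (\<lambda>k. inverse (fact k) * onorm T ^ k * norm x)"
    by (intro summable_mult2 summable_exp)
qed

text \<open>
  In coordinates this is a finite sum of Cauchy products of real series.
\<close>

lemma bilinear_Cauchy_product_sums:
  fixes B :: "'a::euclidean_space \<Rightarrow> 'b::euclidean_space \<Rightarrow> 'c::real_normed_vector"
  assumes B: "bilinear B" and a: "summable (\<lambda>k. norm (a k))" and b: "summable (\<lambda>k. norm (b k))"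
  shows "(\<lambda>k. \<Sum>i\<le>k. B (a i) (b (k - i))) sums B (suminf a) (suminf b)"
proof -
  have expand: "B x y = (\<Sum>e\<in>Basis. \<Sum>f\<in>Basis. ((x \<bullet> e) * (y \<bullet> f)) *\<^sub>R B e f)" for x y
  proof -
    have "B x y = B (\<Sum>e\<in>Basis. (x \<bullet> e) *\<^sub>R e) (\<Sum>f\<in>Basis. (y \<bullet> f) *\<^sub>R f)"
      by (simp add: euclidean_representation)
    also have "\<dots> = (\<Sum>(e, f)\<in>Basis \<times> Basis. B ((x \<bullet> e) *\<^sub>R e) ((y \<bullet> f) *\<^sub>R f))"
      by (rule bilinear_sum[OF B])
    finally show ?thesis
      by (simp add: sum.cartesian_product bilinear_lmul[OF B] bilinear_rmul[OF B] ac_simps)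
  qed
  have inner: "summable (\<lambda>k. norm (c k \<bullet> e))" "suminf c \<bullet> e = suminf (\<lambda>k. c k \<bullet> e)"
    if c: "summable (\<lambda>k. norm (c k))" and e: "e \<in> Basis" for c :: "nat \<Rightarrow> 'd::euclidean_space" and e
  proof -
    show "summable (\<lambda>k. norm (c k \<bullet> e))"
      by (rule summable_comparison_test[OF _ c]) (use Basis_le_norm[OF e] in auto)
    show "suminf c \<bullet> e = suminf (\<lambda>k. c k \<bullet> e)"
      by (rule bounded_linear.suminf[OF bounded_linear_inner_left]) (rule summable_norm_cancel[OF c])
  qed
  have "(\<lambda>k. \<Sum>e\<in>Basis. \<Sum>f\<in>Basis. (\<Sum>i\<le>k. (a i \<bullet> e) * (b (k - i) \<bullet> f)) *\<^sub>R B e f) sums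
      (\<Sum>e\<in>Basis. \<Sum>f\<in>Basis. ((suminf a \<bullet> e) * (suminf b \<bullet> f)) *\<^sub>R B e f)"
  proof (intro sums_sum)
    fix e :: 'a and f :: 'b assume e: "e \<in> Basis" and f: "f \<in> Basis"
    have "(\<lambda>k. \<Sum>i\<le>k. (a i \<bullet> e) * (b (k - i) \<bullet> f)) sums ((suminf a \<bullet> e) * (suminf b \<bullet> f))"
      unfolding inner(2)[OF a e] inner(2)[OF b f]
      by (rule Cauchy_product_sums[OF inner(1)[OF a e] inner(1)[OF b f]])
    then show "(\<lambda>k. (\<Sum>i\<le>k. (a i \<bullet> e) * (b (k - i) \<bullet> f)) *\<^sub>R B e f) sums
        (((suminf a \<bullet> e) * (suminf b \<bullet> f)) *\<^sub>R B e f)"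
      by (rule sums_scaleR_left)
  qed
  moreover have "(\<Sum>e\<in>Basis. \<Sum>f\<in>Basis. (\<Sum>i\<le>k. (a i \<bullet> e) * (b (k - i) \<bullet> f)) *\<^sub>R B e f) =
      (\<Sum>i\<le>k. B (a i) (b (k - i)))" for k
    unfolding expand[of "a _"] scaleR_sum_left
    by (subst sum.swap[where A = "{..k}"], rule sum.cong[OF refl], rule sum.swap)
  ultimately show ?thesis
    unfolding expand[of "suminf a"] by simp
qed

text \<open>
  The binomial theorem for powers of a derivation, divided by \<open>n!\<close>.
\<close>

lemma Leibniz_derivation:
  assumes B: "bilinear B" and C: "linear C" and der: "\<And>u v. C (B u v) = B (T u) v + B u (T v)"
  shows "exp_term C (B u v) n = (\<Sum>i\<le>n. B (exp_term T u i) (exp_term T v (n - i)))"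
proof -
  have "(C ^^ n) (B u v) = (\<Sum>i\<le>n. real (n choose i) *\<^sub>R B ((T ^^ i) u) ((T ^^ (n - i)) v))" for u v
  proof (induction n arbitrary: u v)
    case (Suc n)
    have "(C ^^ Suc n) (B u v) = (C ^^ n) (B (T u) v + B u (T v))"
      by (simp only: funpow_Suc_right o_apply der)
    also have "\<dots> = (C ^^ n) (B (T u) v) + (C ^^ n) (B u (T v))"
      by (induction n) (auto simp: linear_add[OF C])
    also have "\<dots> = (\<Sum>i\<le>n. real (n choose i) *\<^sub>R B ((T ^^ Suc i) u) ((T ^^ (n - i)) v))
        + (\<Sum>i\<le>n. real (n choose i) *\<^sub>R B ((T ^^ i) u) ((T ^^ Suc (n - i)) v))"
      unfolding Suc by (simp only: funpow_Suc_right o_apply)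
    also have "(\<Sum>i\<le>n. real (n choose i) *\<^sub>R B ((T ^^ i) u) ((T ^^ Suc (n - i)) v)) =
        (\<Sum>i\<le>Suc n. real (n choose i) *\<^sub>R B ((T ^^ i) u) ((T ^^ (Suc n - i)) v))"
      by (simp add: Suc_diff_le)
    also have "\<dots> = B u ((T ^^ Suc n) v) +
        (\<Sum>i\<le>n. real (n choose Suc i) *\<^sub>R B ((T ^^ Suc i) u) ((T ^^ (n - i)) v))"
      by (subst sum.atMost_Suc_shift) simp
    also have "(\<Sum>i\<le>n. real (n choose i) *\<^sub>R B ((T ^^ Suc i) u) ((T ^^ (n - i)) v)) + (B u ((T ^^ Suc n) v) +
        (\<Sum>i\<le>n. real (n choose Suc i) *\<^sub>R B ((T ^^ Suc i) u) ((T ^^ (n - i)) v))) =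
        B u ((T ^^ Suc n) v) + (\<Sum>i\<le>n. real (Suc n choose Suc i) *\<^sub>R B ((T ^^ Suc i) u) ((T ^^ (n - i)) v))"
      by (simp add: sum.distrib scaleR_add_left)
    also have "\<dots> = (\<Sum>i\<le>Suc n. real (Suc n choose i) *\<^sub>R B ((T ^^ i) u) ((T ^^ (Suc n - i)) v))"
      by (subst sum.atMost_Suc_shift) simp
    finally show ?case .
  qed simp
  moreover have "real (n choose i) / fact n = 1 / (fact (n - i) * fact i)" if "i \<le> n" for i
    using that by (simp add: binomial_fact)
  ultimately show ?thesis
    unfolding exp_term_def
    by (simp add: scaleR_sum_right bilinear_lmul[OF B] bilinear_rmul[OF B])
qed

lemma matrix_exp_mult_vec: "matrix_exp A *v u = suminf (exp_term ((*v) A) u)"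
proof -
  have "bilinear ((**) :: real^7^7 \<Rightarrow> real^7^7 \<Rightarrow> real^7^7)"
    by (simp add: bilinear_def linear_iff vec_eq_iff matrix_matrix_mult_def sum.distrib
        sum_distrib_left algebra_simps)
  then have "linear ((**) A :: real^7^7 \<Rightarrow> real^7^7)"
    by (simp add: bilinear_def)
  then have "bounded_linear ((**) A :: real^7^7 \<Rightarrow> real^7^7)"
    by (rule linear_conv_bounded_linear[THEN iffD1])
  then have s: "summable (exp_term ((**) A) (mat 1))"
    by (intro summable_norm_cancel[OF summable_exp_term])
  have "linear (\<lambda>M::real^7^7. M *v u)"
    by (simp add: linear_iff matrix_vector_mult_add_rdistrib scaleR_matrix_vector_assoc)
  then have bl: "bounded_linear (\<lambda>M::real^7^7. M *v u)"
    by (rule linear_conv_bounded_linear[THEN iffD1])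
  have "(((**) A) ^^ k) (mat 1) *v u = (((*v) A) ^^ k) u" for k
    by (induction k) (simp_all add: matrix_vector_mul_assoc[symmetric])
  then have "exp_term ((**) A) (mat 1) k *v u = exp_term ((*v) A) u k" for k
    by (simp add: exp_term_def scaleR_matrix_vector_assoc[symmetric])
  then show ?thesis
    using bounded_linear.suminf[OF bl s]
    unfolding matrix_exp_def exp_term_def[symmetric, abs_def] by simp
qed

text \<open>
  The exponential of a derivation is an automorphism.  The linear map \<open>C\<close> on the values of \<open>B\<close> is kept separate from
  \<open>A\<close>, so that \<open>C = A\<close> covers the cross product and \<open>C = 0\<close> the invariance of the inner product.
\<close>

lemma matrix_exp_bilinear:
  fixes B :: "real^7 \<Rightarrow> real^7 \<Rightarrow> 'c::real_normed_vector"
  assumes B: "bilinear B" and C: "linear C" and der: "\<And>u v. C (B u v) = B (A *v u) v + B u (A *v v)"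
  shows "B (matrix_exp A *v u) (matrix_exp A *v v) = suminf (exp_term C (B u v))"
proof -
  have bl: "bounded_linear ((*v) A)"
    by (rule matrix_vector_mul_bounded_linear)
  have "(\<lambda>k. \<Sum>i\<le>k. B (exp_term ((*v) A) u i) (exp_term ((*v) A) v (k - i))) sums
      B (matrix_exp A *v u) (matrix_exp A *v v)"
    unfolding matrix_exp_mult_vec
    by (intro bilinear_Cauchy_product_sums[OF B] summable_exp_term bl)
  then show ?thesis
    unfolding Leibniz_derivation[OF B C der, symmetric] by (simp add: sums_iff)
qed

lemma matrix_exp_cross7:
  assumes "A \<in> g2"
  shows "matrix_exp A *v cross7 u v = cross7 (matrix_exp A *v u) (matrix_exp A *v v)"
  unfolding matrix_exp_bilinear[OF bilinear_cross7 matrix_vector_mul_linear g2_derivation_cross7[OF assms]]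
  by (rule matrix_exp_mult_vec)

lemma matrix_exp_inner:
  assumes "A \<in> g2"
  shows "(matrix_exp A *v u) \<bullet> (matrix_exp A *v v) = u \<bullet> v"
proof -
  have "bilinear ((\<bullet>) :: real^7 \<Rightarrow> _)"
    by (simp add: bilinear_conv_bounded_bilinear bounded_bilinear_inner)
  from matrix_exp_bilinear[OF this linear_zero, of A u v] g2_derivation_inner[OF assms]
  have "(matrix_exp A *v u) \<bullet> (matrix_exp A *v v) = suminf (exp_term (\<lambda>_. 0) (u \<bullet> v))"
    by simp
  also have "\<dots> = (\<Sum>k\<in>{0}. exp_term (\<lambda>_. 0) (u \<bullet> v) k)"
    by (rule suminf_finite) (auto simp: exp_term_def gr0_conv_Suc)
  finally show ?thesis
    by (simp add: exp_term_def)
qed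

lemma G2_automorphism:
  assumes "g \<in> G2"
  shows "g *v cross7 u v = cross7 (g *v u) (g *v v)" and "(g *v u) \<bullet> (g *v v) = u \<bullet> v"
proof -
  have "(\<forall>u v. g *v cross7 u v = cross7 (g *v u) (g *v v)) \<and> (\<forall>u v. (g *v u) \<bullet> (g *v v) = u \<bullet> v)"
    using assms
    by induction (simp_all add: matrix_vector_mul_assoc[symmetric] matrix_exp_cross7 matrix_exp_inner)
  then show "g *v cross7 u v = cross7 (g *v u) (g *v v)" "(g *v u) \<bullet> (g *v v) = u \<bullet> v"
    by blast+
qed

lemma G2_matrix_inv:
  assumes "g \<in> G2"
  shows "matrix_inv g ** g = mat 1" "g ** matrix_inv g = mat 1"
proof -
  have "orthogonal_transformation ((*v) g)"
    by (simp add: orthogonal_transformation_def G2_automorphism(2)[OF assms])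
  then have "orthogonal_matrix g"
    by (simp add: orthogonal_transformation_matrix)
  then have "\<exists>B. g ** B = mat 1 \<and> B ** g = mat 1"
    unfolding orthogonal_matrix_def by blast
  then have "g ** matrix_inv g = mat 1 \<and> matrix_inv g ** g = mat 1"
    unfolding matrix_inv_def by (rule someI_ex)
  then show "matrix_inv g ** g = mat 1" "g ** matrix_inv g = mat 1"
    by blast+
qed

text \<open>
  On the plane of \<open>u\<close> and \<open>w\<close> the map \<open>T\<close> is \<open>t\<close> times a quarter turn, so its exponential is the
  rotation by the angle \<open>t\<close>.
\<close>

lemma exp_rotation:
  assumes T: "linear T" and u: "T u = t *\<^sub>R w" and w: "T w = - t *\<^sub>R u"
  shows "suminf (exp_term T u) = cos t *\<^sub>R u + sin t *\<^sub>R (w :: 'a::real_normed_vector)"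
proof -
  have "exp_term T u k = (cos_coeff k * t ^ k) *\<^sub>R u + (sin_coeff k * t ^ k) *\<^sub>R w" for k
  proof (induction k)
    case 0
    then show ?case by (simp add: exp_term_def)
  next
    case (Suc k)
    have "exp_term T u (Suc k) = (1 / real (Suc k)) *\<^sub>R T (exp_term T u k)"
      by (simp add: exp_term_def linear_scale[OF T])
    also have "\<dots> = (1 / real (Suc k)) *\<^sub>R ((cos_coeff k * t ^ k) *\<^sub>R (t *\<^sub>R w) + (sin_coeff k * t ^ k) *\<^sub>R (- t *\<^sub>R u))"
      unfolding Suc by (simp add: linear_add[OF T] linear_scale[OF T] u w)
    also have "\<dots> = (cos_coeff (Suc k) * t ^ Suc k) *\<^sub>R u + (sin_coeff (Suc k) * t ^ Suc k) *\<^sub>R w"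
      by (simp add: cos_coeff_Suc sin_coeff_Suc scaleR_diff_right ac_simps)
    finally show ?case .
  qed
  then have "exp_term T u = (\<lambda>k. (cos_coeff k * t ^ k) *\<^sub>R u + (sin_coeff k * t ^ k) *\<^sub>R w)"
    by (rule ext)
  moreover have "(\<lambda>k. (cos_coeff k * t ^ k) *\<^sub>R u + (sin_coeff k * t ^ k) *\<^sub>R w) sums (cos t *\<^sub>R u + sin t *\<^sub>R w)"
    using cos_converges[of t] sin_converges[of t] by (intro sums_add sums_scaleR_left) simp_all
  ultimately show ?thesis
    by (simp add: sums_iff)
qed

lemma first_column_surj: "v $ 1 = 0 \<Longrightarrow> \<exists>a. first_column a = v"
  by (intro exI[of _ "vector [Complex (- v$3 / 2) (v$2 / 2), Complex (- v$5 / 2) (v$4 / 2), Complex (- v$7 / 2) (v$6 / 2)]"])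
    (simp add: vec_eq_iff forall_7 first_column_nth)

lemma e1_simps: "e1 $ 1 = 1" "x \<bullet> e1 = x $ 1" "e1 \<bullet> x = x $ 1"
  by (simp_all add: e1_def inner_axis inner_axis')

lemma g2_rep_e1: "g2_rep a *v e1 = first_column a"
  by (rule g2_column_1[OF g2_rep_params])

text \<open>
  Together with \<open>g2_rep_e1\<close> this makes \<open>g2_rep (t b)\<close> an infinitesimal rotation of the plane of \<open>e\<^sub>1\<close> and
  \<open>first_column b\<close>, and every plane through \<open>e\<^sub>1\<close> arises in this way.
\<close>

lemma g2_rep_first_column: "g2_rep (t *\<^sub>R b) *v first_column b = - (t * (first_column b \<bullet> first_column b)) *\<^sub>R e1"
  unfolding vec_eq_iff forall_7 mult_vec_7
  by (simp add: g2_rep_def Let_def first_column_nth inner_7 e1_def axis_def algebra_simps)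

lemma first_column_add: "first_column (a + b) = first_column a + first_column b"
  by (simp add: vec_eq_iff forall_7 first_column_nth)

lemma first_column_scale: "first_column (r *\<^sub>R a) = r *\<^sub>R first_column a"
  by (simp add: vec_eq_iff forall_7 first_column_nth)

lemma cross7_e1_first_column: "cross7 e1 (first_column a) = first_column (\<i> *s a)"
  by (simp add: vec_eq_iff forall_7 first_column_nth cross7_nth e1_def axis_def)

lemma first_column_inject: "first_column a = first_column b \<Longrightarrow> a = b"
  by (simp add: vec_eq_iff forall_7 forall_3 first_column_nth complex_eq_iff)

lemma first_column_1: "first_column a \<bullet> e1 = 0"
  by (simp add: e1_simps first_column_nth)

text \<open>
  A single exponential suffices: it rotates \<open>e\<^sub>1\<close> to \<open>y\<close> in the plane spanned by both.
\<close>

lemma G2_transitive: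
  assumes "y \<in> S6"
  shows "\<exists>g\<in>G2. g *v e1 = y"
proof -
  have yy: "y \<bullet> y = 1"
    using assms by (simp add: S6_def norm_eq_1)
  define r where "r = y - y$1 *\<^sub>R e1"
  have r: "r $ 1 = 0" "r \<bullet> r = 1 - (y$1)\<^sup>2"
    using yy by (simp_all add: r_def e1_simps inner_diff_left inner_diff_right power2_eq_square)
  then have "(y$1)\<^sup>2 \<le> 1"
    using inner_ge_zero[of r] by linarith
  then have y1: "- 1 \<le> y $ 1" "y $ 1 \<le> 1"
    by (simp_all add: abs_square_le_1 abs_le_iff)
  define t where "t = arccos (y $ 1)"
  have t: "cos t = y $ 1" "sin t = norm r"
    using y1 r(2) by (simp_all add: t_def sin_arccos norm_eq_sqrt_inner)
  \<comment> \<open>If \<open>y\<close> is \<open>e\<^sub>1\<close> or its antipode, any unit vector orthogonal to \<open>e\<^sub>1\<close> will do.\<close>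
  obtain w where w: "w $ 1 = 0" "w \<bullet> w = 1" "r = norm r *\<^sub>R w"
  proof (cases "r = 0")
    case True
    show thesis
      by (rule that[of "axis 2 1"]) (simp add: axis_def, simp_all add: True inner_axis)
  next
    case False
    show thesis
      by (rule that[of "r /\<^sub>R norm r"]) (use False r in \<open>simp_all add: dot_square_norm power2_eq_square\<close>)
  qed
  obtain b where b: "first_column b = w"
    using first_column_surj[OF w(1)] by blast
  define A where "A = g2_rep (t *\<^sub>R b)"
  have "A \<in> g2"
    unfolding A_def g2_def using g2_rep_params by blast
  have "A *v e1 = t *\<^sub>R w" "A *v w = - t *\<^sub>R e1"
    using g2_rep_first_column[of t b] by (simp_all add: A_def g2_rep_e1 first_column_scale b w)
  then have "matrix_exp A *v e1 = cos t *\<^sub>R e1 + sin t *\<^sub>R w"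
    unfolding matrix_exp_mult_vec by (intro exp_rotation matrix_vector_mul_linear)
  also have "\<dots> = y"
    using w(3) by (simp add: t r_def)
  finally have "(matrix_exp A ** mat 1) *v e1 = y"
    by simp
  then show ?thesis
    using G2.step[OF \<open>A \<in> g2\<close> G2.one] by blast
qed

lemma tangent_eq_first_column:
  assumes "g \<in> G2" "v \<bullet> (g *v e1) = 0"
  shows "\<exists>a. v = g *v first_column a"
proof -
  have v: "v = g *v (matrix_inv g *v v)"
    by (simp add: matrix_vector_mul_assoc G2_matrix_inv(2)[OF assms(1)])
  have "(matrix_inv g *v v) \<bullet> e1 = 0"
    using G2_automorphism(2)[OF assms(1), of "matrix_inv g *v v" e1] assms(2) v by simp
  then show ?thesis
    using v first_column_surj[of "matrix_inv g *v v"] by (metis e1_simps(2))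
qed

text \<open>
  A tangent vector of \<open>G2\<close> at \<open>g\<close> has the form \<open>g A\<close> with \<open>A\<close> in \<open>g2\<close>, and it maps to \<open>g (A e\<^sub>1)\<close>, from which the parameter
  \<open>a\<close> of \<open>A\<close> can be read off.
\<close>

lemma theta_desc_first_column:
  assumes g: "g \<in> G2"
  shows "theta_desc g (g *v first_column a) = a"
proof -
  have mc: "maurer_cartan g (g ** A) = A" for A
    by (simp add: maurer_cartan_def matrix_mul_assoc G2_matrix_inv(1)[OF g])
  have th: "theta g (g ** A) = b" if "has_g2_params A b D" for A b D
    unfolding theta_def mc
  proof (rule the_equality)
    show "\<exists>D. has_g2_params A b D"
      using that by blast
    show "c = b" if "\<exists>D. has_g2_params A c D" for c
      using that \<open>has_g2_params A b D\<close> g2_column_1 first_column_inject by metis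
  qed
  show ?thesis
    unfolding theta_desc_def
  proof (rule the_equality)
    show "\<exists>X\<in>tangent_G2 g. X *v e1 = g *v first_column a \<and> theta g X = a"
    proof (intro bexI[of _ "g ** g2_rep a"] conjI)
      show "(g ** g2_rep a) *v e1 = g *v first_column a"
        by (simp add: matrix_vector_mul_assoc[symmetric] g2_rep_e1)
      show "theta g (g ** g2_rep a) = a"
        by (rule th[OF g2_rep_params])
      show "g ** g2_rep a \<in> tangent_G2 g"
        unfolding tangent_G2_def g2_def using g2_rep_params by blast
    qed
    fix b assume "\<exists>X\<in>tangent_G2 g. X *v e1 = g *v first_column a \<and> theta g X = b"
    then obtain A where A: "A \<in> g2" "(g ** A) *v e1 = g *v first_column a" "theta g (g ** A) = b"
      by (auto simp: tangent_G2_def)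
    obtain c D where c: "has_g2_params A c D"
      using A(1) by (auto simp: g2_def)
    have "g *v first_column c = g *v first_column a"
      using A(2) g2_column_1[OF c] by (simp add: matrix_vector_mul_assoc[symmetric])
    then have "matrix_inv g *v (g *v first_column c) = matrix_inv g *v (g *v first_column a)"
      by simp
    then have "first_column c = first_column a"
      by (simp add: matrix_vector_mul_assoc G2_matrix_inv(1)[OF g])
    then have "c = a"
      by (rule first_column_inject)
    then show "b = a"
      using th[OF c] A(3) by simp
  qed
qed

text \<open>
  As \<open>g\<close> preserves the cross product, multiplication by \<open>y \<times> _\<close> at \<open>y = g e\<^sub>1\<close> corresponds to \<open>e\<^sub>1 \<times> _\<close> at
  \<open>e\<^sub>1\<close>, whatever \<open>g\<close> is.  This is why the span of the forms \<open>\<theta>\<close> at \<open>y\<close> depends on \<open>y\<close> only.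
\<close>

lemma cross7_G2_first_column:
  assumes "g \<in> G2"
  shows "cross7 (g *v e1) (g *v first_column a) = g *v first_column (\<i> *s a)"
  using G2_automorphism(1)[OF assms, of e1 "first_column a"] by (simp add: cross7_e1_first_column)

lemma real_linear_complex3:
  fixes \<beta> :: "complex^3 \<Rightarrow> complex"
  assumes add: "\<And>a b. \<beta> (a + b) = \<beta> a + \<beta> b" and scale: "\<And>r a. \<beta> (r *\<^sub>R a) = r *\<^sub>R \<beta> a"
  shows "\<beta> a = (\<Sum>k\<in>UNIV. Re (a$k) *\<^sub>R \<beta> (axis k 1) + Im (a$k) *\<^sub>R \<beta> (\<i> *s axis k 1))"
proof -
  have lin: "linear \<beta>"
    by (intro linearI add scale)
  have "a = (\<Sum>k\<in>UNIV. Re (a$k) *\<^sub>R axis k 1 + Im (a$k) *\<^sub>R (\<i> *s axis k 1))"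
    by (simp add: vec_eq_iff sum_3 forall_3 axis_def complex_eq_iff)
  then have "\<beta> a = \<beta> (\<Sum>k\<in>UNIV. Re (a$k) *\<^sub>R axis k 1 + Im (a$k) *\<^sub>R (\<i> *s axis k 1))"
    by simp
  also have "\<dots> = (\<Sum>k\<in>UNIV. Re (a$k) *\<^sub>R \<beta> (axis k 1) + Im (a$k) *\<^sub>R \<beta> (\<i> *s axis k 1))"
    by (simp only: linear_sum[OF lin] add scale)
  finally show ?thesis .
qed

lemma complex_structure_cross7:
  assumes "y \<in> S6"
  shows "complex_structure_on_tangent y (cross7 y)"
  using assms
  by (simp add: complex_structure_on_tangent_def real_linear_on_tangent_def tangent_S6_def
      cross7.add_right cross7.scaleR_right cross7_cross7 S6_def norm_eq_1 inner_commute)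

text \<open>
  Through \<open>a \<mapsto> g (first_column a)\<close> real-linear forms on \<open>T\<^sub>yS\<^sup>6\<close> become real-linear forms on \<open>\<complex>\<^sup>3\<close>, and \<open>y \<times> _\<close>
  becomes multiplication by \<open>\<i>\<close>.
\<close>

lemma forms_on_tangent:
  assumes g: "g \<in> G2" and y: "g *v e1 = y" and \<alpha>: "real_linear_on_tangent y (\<alpha> :: real^7 \<Rightarrow> complex)"
  shows "(\<forall>v\<in>tangent_S6 y. \<alpha> (cross7 y v) = \<i> * \<alpha> v) \<longleftrightarrow>
      (\<exists>c :: complex^3. \<forall>v\<in>tangent_S6 y. \<alpha> v = (\<Sum>k\<in>UNIV. c $ k * theta_desc g v $ k))" (is ?A)
    and "(\<forall>v\<in>tangent_S6 y. \<alpha> (cross7 y v) = - \<i> * \<alpha> v) \<longleftrightarrow>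
      (\<exists>c :: complex^3. \<forall>v\<in>tangent_S6 y. \<alpha> v = (\<Sum>k\<in>UNIV. c $ k * cnj (theta_desc g v $ k)))" (is ?B)
proof -
  have tangent: "tangent_S6 y = range (\<lambda>a. g *v first_column a)"
  proof
    show "tangent_S6 y \<subseteq> range (\<lambda>a. g *v first_column a)"
      using tangent_eq_first_column[OF g] by (auto simp: tangent_S6_def y)
    show "range (\<lambda>a. g *v first_column a) \<subseteq> tangent_S6 y"
      by (auto simp: tangent_S6_def y[symmetric] G2_automorphism(2)[OF g] first_column_1)
  qed
  define \<beta> where "\<beta> = (\<lambda>a. \<alpha> (g *v first_column a))"
  have t: "g *v first_column a \<in> tangent_S6 y" for a
    by (simp add: tangent)
  have add: "\<beta> (a + b) = \<beta> a + \<beta> b" and scale: "\<beta> (r *\<^sub>R a) = r *\<^sub>R \<beta> a" for a b r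
    using \<alpha> t by (simp_all add: \<beta>_def real_linear_on_tangent_def first_column_add first_column_scale
        matrix_vector_right_distrib matrix_vector_mult_scaleR)
  have J: "\<alpha> (cross7 y (g *v first_column a)) = \<beta> (\<i> *s a)" for a
    unfolding \<beta>_def y[symmetric] cross7_G2_first_column[OF g] ..
  have exp: "\<beta> a = (\<Sum>k\<in>UNIV. Re (a$k) *\<^sub>R \<beta> (axis k 1) + Im (a$k) *\<^sub>R \<beta> (\<i> *s axis k 1))" for a
    by (rule real_linear_complex3[OF add scale])
  have "(\<forall>a. \<beta> (\<i> *s a) = \<i> * \<beta> a) \<longleftrightarrow> (\<exists>c :: complex^3. \<forall>a. \<beta> a = (\<Sum>k\<in>UNIV. c $ k * a $ k))"
  proof
    assume L: "\<forall>a. \<beta> (\<i> *s a) = \<i> * \<beta> a"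
    have "\<beta> a = (\<Sum>k\<in>UNIV. (\<chi> k. \<beta> (axis k 1)) $ k * a $ k)" for a
      by (subst exp, rule sum.cong) (simp_all add: L complex_eq_iff)
    then show "\<exists>c :: complex^3. \<forall>a. \<beta> a = (\<Sum>k\<in>UNIV. c $ k * a $ k)" by blast
  qed (auto simp: sum_distrib_left ac_simps)
  then show ?A
    by (simp add: tangent J theta_desc_first_column[OF g]) (simp add: \<beta>_def)
  have "(\<forall>a. \<beta> (\<i> *s a) = - \<i> * \<beta> a) \<longleftrightarrow> (\<exists>c :: complex^3. \<forall>a. \<beta> a = (\<Sum>k\<in>UNIV. c $ k * cnj (a $ k)))"
  proof
    assume L: "\<forall>a. \<beta> (\<i> *s a) = - \<i> * \<beta> a"
    have "\<beta> a = (\<Sum>k\<in>UNIV. (\<chi> k. \<beta> (axis k 1)) $ k * cnj (a $ k))" for a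
      by (subst exp, rule sum.cong) (simp_all add: L complex_eq_iff)
    then show "\<exists>c :: complex^3. \<forall>a. \<beta> a = (\<Sum>k\<in>UNIV. c $ k * cnj (a $ k))" by blast
  qed (auto simp: sum_distrib_left sum_negf ac_simps)
  then show ?B
    by (simp add: tangent J theta_desc_first_column[OF g]) (simp add: \<beta>_def)
qed

text \<open>
  By \<open>forms_on_tangent\<close> the cross product is a possible choice for \<open>J_can\<close>.  Any other choice agrees with it because
  the coordinates of \<open>\<theta>\<close> are (1,0)-forms and separate tangent vectors.
\<close>

lemma J_can_eq_cross7:
  assumes y: "y \<in> S6" and v: "v \<bullet> y = 0"
  shows "J_can y v = cross7 y v"
proof -
  have "J_can_at y (cross7 y)"
    unfolding J_can_at_def using complex_structure_cross7[OF y] forms_on_tangent by blast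
  then have j: "J_can_at y (J_can y)"
    unfolding J_can_def by (rule someI[of "J_can_at y"])
  obtain g where g: "g \<in> G2" "g *v e1 = y"
    using G2_transitive[OF y] by blast
  have vt: "v \<in> tangent_S6 y"
    using v by (simp add: tangent_S6_def)
  then have jt: "J_can y v \<bullet> y = 0"
    using j by (simp add: J_can_at_def complex_structure_on_tangent_def tangent_S6_def)
  obtain a where a: "v = g *v first_column a"
    using tangent_eq_first_column[OF g(1)] v g(2) by auto
  obtain b where b: "J_can y v = g *v first_column b"
    using tangent_eq_first_column[OF g(1)] jt g(2) by auto
  have "b $ k = \<i> * a $ k" for k
  proof -
    define \<alpha> where "\<alpha> = (\<lambda>v. theta_desc g v $ k)"
    have lin: "real_linear_on_tangent y \<alpha>"
      unfolding real_linear_on_tangent_def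
    proof (intro conjI ballI allI)
      have *: "\<exists>a. v = g *v first_column a" if "v \<in> tangent_S6 y" for v
        using tangent_eq_first_column[OF g(1), of v] that g(2) by (simp add: tangent_S6_def)
      have \<alpha>: "\<alpha> (g *v first_column a) = a $ k" for a
        by (simp add: \<alpha>_def theta_desc_first_column[OF g(1)])
      show "\<alpha> (u + v) = \<alpha> u + \<alpha> v" if uv: "u \<in> tangent_S6 y" "v \<in> tangent_S6 y" for u v
        using *[OF uv(1)] *[OF uv(2)]
        by (auto simp: \<alpha> matrix_vector_right_distrib[symmetric] first_column_add[symmetric])
      show "\<alpha> (c *\<^sub>R v) = c *\<^sub>R \<alpha> v" if "v \<in> tangent_S6 y" for c v
        using *[OF that]
        by (auto simp: \<alpha> matrix_vector_mult_scaleR[symmetric] first_column_scale[symmetric])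
    qed
    have "\<exists>c :: complex^3. \<forall>v\<in>tangent_S6 y. \<alpha> v = (\<Sum>l\<in>UNIV. c $ l * theta_desc g v $ l)"
      by (rule exI[of _ "axis k 1"]) (simp add: \<alpha>_def axis_def if_distrib if_distribR cong: if_cong)
    then have "\<alpha> (J_can y v) = \<i> * \<alpha> v"
      using j lin g vt unfolding J_can_at_def by blast
    then show ?thesis
      by (simp add: \<alpha>_def b) (simp add: a theta_desc_first_column[OF g(1)])
  qed
  then have "b = \<i> *s a"
    by (simp add: vec_eq_iff)
  then show ?thesis
    using cross7_G2_first_column[OF g(1), of a] by (simp add: a[symmetric] b g(2))
qed

section \<open>Compatible complex structures on one tangent space\<close>

text \<open>
  Adding \<open>v \<noteq> 0\<close> to the list would give more than \<open>DIM('a)\<close> independent vectors.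
\<close>

lemma orthogonal_list_complete:
  fixes xs :: "'a::euclidean_space list"
  assumes "sorted_wrt (\<lambda>a b. a \<bullet> b = 0) xs" "0 \<notin> set xs" "length xs = DIM('a)"
    and v: "\<forall>x\<in>set xs. v \<bullet> x = 0"
  shows "v = 0"
proof (rule ccontr)
  assume "v \<noteq> 0"
  define ys where "ys = v # xs"
  have ys: "sorted_wrt (\<lambda>a b. a \<bullet> b = 0) ys" "0 \<notin> set ys"
    using assms \<open>v \<noteq> 0\<close> by (auto simp: ys_def)
  have inj: "ys ! i \<bullet> ys ! j = 0" if "i < length ys" "j < length ys" "i \<noteq> j" for i j
  proof (cases "i < j")
    case True
    then show ?thesis using sorted_wrt_nth_less[OF ys(1)] that by blast
  next
    case False
    then have "ys ! j \<bullet> ys ! i = 0" using sorted_wrt_nth_less[OF ys(1), of j i] that by simp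
    then show ?thesis by (simp add: inner_commute)
  qed
  have dist: "distinct ys"
    unfolding distinct_conv_nth using inj ys(2) by (metis inner_eq_zero_iff nth_mem)
  have "pairwise orthogonal (set ys)"
    unfolding pairwise_def orthogonal_def by (metis in_set_conv_nth inj)
  then have "independent (set ys)"
    using ys(2) by (rule pairwise_orthogonal_independent)
  then have "card (set ys) \<le> DIM('a)"
    by (rule independent_card_le)
  then show False
    using distinct_card[OF dist] assms(3) by (simp add: ys_def)
qed

lemma orthogonal_to_few_vectors:
  fixes xs :: "'a::euclidean_space list"
  assumes "length xs < DIM('a)"
  shows "\<exists>v. v \<noteq> 0 \<and> (\<forall>x\<in>set xs. v \<bullet> x = 0)"
proof -
  have "dim (set xs) < DIM('a)"
    using assms card_length[of xs] dim_le_card'[of "set xs"] by simp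
  from orthogonal_to_subspace_exists[OF this]
  obtain v where v: "v \<noteq> 0" "\<And>x. x \<in> span (set xs) \<Longrightarrow> orthogonal v x"
    by metis
  have "\<forall>x\<in>set xs. v \<bullet> x = 0"
    using v(2) span_base[of _ "set xs"] by (simp add: orthogonal_def)
  with v(1) show ?thesis by (intro exI conjI)
qed

locale compatible_structure =
  fixes y :: "real^7" and J :: "real^7 \<Rightarrow> real^7"
  assumes unit: "y \<bullet> y = 1"
    and linear_J: "linear J"
    and J_tangent: "v \<bullet> y = 0 \<Longrightarrow> J v \<bullet> y = 0"
    and J_J: "v \<bullet> y = 0 \<Longrightarrow> J (J v) = - v"
    and compat: "u \<bullet> y = 0 \<Longrightarrow> v \<bullet> y = 0 \<Longrightarrow> cross7 y (J u) \<bullet> J v = cross7 y u \<bullet> v"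
begin

abbreviation K :: "real^7 \<Rightarrow> real^7" where "K \<equiv> cross7 y"

lemmas J_scale = linear_scale[OF linear_J]
lemmas J_add = linear_add[OF linear_J]
lemmas J_0 = linear_0[OF linear_J]

lemma K_K: "v \<bullet> y = 0 \<Longrightarrow> K (K v) = - v"
  by (simp add: cross7_cross7 unit inner_commute)

lemma K_skew: "K u \<bullet> v = - (u \<bullet> K v)"
  by (rule inner_cross7_skew)

lemma K_isometry: "u \<bullet> y = 0 \<Longrightarrow> K u \<bullet> K v = u \<bullet> v"
  by (simp add: K_skew[of u] cross7_cross7 unit inner_diff_right inner_commute)

lemma form_symmetric:
  assumes "u \<bullet> y = 0" "v \<bullet> y = 0"
  shows "K u \<bullet> J v = K v \<bullet> J u"
proof -
  have "K u \<bullet> J v = K (J u) \<bullet> J (J v)"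
    using compat[OF assms(1) J_tangent[OF assms(2)]] by simp
  also have "\<dots> = K v \<bullet> J u"
    using assms by (simp add: J_J K_skew[of v] K_skew[of "J u"] inner_commute[of v])
  finally show ?thesis .
qed

definition eigen :: "real^7 \<Rightarrow> real \<Rightarrow> bool" where
  "eigen u l \<longleftrightarrow> u \<bullet> y = 0 \<and> u \<bullet> u = 1 \<and> l \<noteq> 0 \<and> J u = l *\<^sub>R K u"

lemma eigen_K:
  assumes "eigen u l"
  shows "J (K u) = (- 1 / l) *\<^sub>R u"
proof -
  have "- u = J (J u)"
    using J_J[of u] assms unfolding eigen_def by metis
  also have "\<dots> = l *\<^sub>R J (K u)"
    using assms by (simp add: eigen_def J_scale)
  finally have "- u = l *\<^sub>R J (K u)" .
  then have "(-1/l) *\<^sub>R u = (1/l) *\<^sub>R (l *\<^sub>R J (K u))"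
    by (metis minus_divide_left scaleR_minus_left scaleR_minus_right)
  then show ?thesis
    using assms by (simp add: eigen_def)
qed

text \<open>
  Maximize the symmetric form \<open>\<omega>(u, J u)\<close> over the unit sphere of \<open>W\<close>.
\<close>

lemma exists_eigen:
  assumes W: "subspace W" "W \<subseteq> {v. v \<bullet> y = 0}" and nz: "w0 \<in> W" "w0 \<noteq> 0"
    and KW: "\<And>w. w \<in> W \<Longrightarrow> K w \<in> W" and JW: "\<And>w. w \<in> W \<Longrightarrow> J w \<in> W"
  shows "\<exists>u\<in>W. \<exists>l. eigen u l"
proof -
  define b where "b = (\<lambda>u v. K u \<bullet> J v)"
  have cont: "continuous_on UNIV (\<lambda>u. b u u)"
    unfolding b_def
    by (intro continuous_intros linear_continuous_on cross7.continuous_on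
          linear_continuous_on_compose[OF _ linear_J])
  have Wt: "w \<bullet> y = 0" if "w \<in> W" for w
    using that W by auto
  have cpt: "compact (sphere 0 1 \<inter> W)"
    using W by (simp add: compact_Int_closed closed_subspace)
  have "w0 /\<^sub>R norm w0 \<in> sphere 0 1 \<inter> W"
    using nz W by (simp add: subspace_scale)
  then have ne: "sphere 0 1 \<inter> W \<noteq> {}"
    by blast
  have "\<exists>u\<in>sphere 0 1 \<inter> W. \<forall>w\<in>sphere 0 1 \<inter> W. b w w \<le> b u u"
    by (rule continuous_attains_sup[OF cpt ne continuous_on_subset[OF cont subset_UNIV]])
  then obtain u where u: "u \<in> sphere 0 1 \<inter> W" and
    max: "\<And>w. w \<in> sphere 0 1 \<inter> W \<Longrightarrow> b w w \<le> b u u"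
    by metis
  define l where "l = b u u"
  have uW: "u \<in> W" and uu: "u \<bullet> u = 1" and ut: "u \<bullet> y = 0"
    using u Wt by (auto simp: dot_square_norm)
  have le: "b w w \<le> l * (w \<bullet> w)" if "w \<in> W" for w
  proof (cases "w = 0")
    case False
    have "b (w /\<^sub>R norm w) (w /\<^sub>R norm w) \<le> l"
      unfolding l_def using that False W by (intro max) (simp add: subspace_scale)
    then have "b w w / (norm w)\<^sup>2 \<le> l"
      by (simp add: b_def cross7.scaleR_right J_scale divide_simps power2_eq_square)
    then show ?thesis
      using False by (simp add: divide_simps power2_norm_eq_inner)
  qed (simp add: b_def cross7.zero_right)
  have orth: "b u w = l * (u \<bullet> w)" if w: "w \<in> W" for w
  proof -
    define q where "q = l * (u \<bullet> w) - b u w"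
    define r where "r = l * (w \<bullet> w) - b w w"
    have sym: "b w u = b u w"
      unfolding b_def using form_symmetric Wt w ut by blast
    have pos: "0 \<le> 2 * t * q + t\<^sup>2 * r" for t
    proof -
      have "u + t *\<^sub>R w \<in> W"
        using W uW w by (simp add: subspace_add subspace_scale)
      from le[OF this] have "b u u + t * b u w + t * b w u + t * t * b w w \<le>
        l * (u \<bullet> u + 2 * t * (u \<bullet> w) + t * t * (w \<bullet> w))"
        by (simp add: b_def cross7.add_right cross7.scaleR_right J_add J_scale inner_add_left
            inner_add_right inner_commute algebra_simps)
      then show ?thesis
        using sym uu by (simp add: q_def r_def l_def algebra_simps power2_eq_square)
    qed
    have "r \<ge> 0"
      using le[OF w] by (simp add: r_def)
    \<comment> \<open>The discriminant argument: for \<open>q \<noteq> 0\<close> the quadratic in \<open>t\<close> is negative at \<open>- q / (r + 1)\<close>, where \<open>r + 1\<close> also allows \<open>r = 0\<close>.\<close>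
    have "2 * (- q / (r + 1)) * q + (- q / (r + 1))\<^sup>2 * r = - (q\<^sup>2 * (r + 2) / (r + 1)\<^sup>2)"
      using \<open>r \<ge> 0\<close> by (simp add: divide_simps power2_eq_square) (simp add: algebra_simps)
    then have "q\<^sup>2 * (r + 2) / (r + 1)\<^sup>2 \<le> 0"
      using pos[of "- q / (r + 1)"] by linarith
    then have "q\<^sup>2 * (r + 2) \<le> 0"
      using \<open>r \<ge> 0\<close> by (simp add: divide_le_0_iff)
    then have "q = 0"
      using \<open>r \<ge> 0\<close> by (simp add: mult_le_0_iff)
    then show ?thesis
      by (simp add: q_def)
  qed
  \<comment> \<open>Both terms lie in \<open>W\<close>, and \<open>orth\<close> says that their sum is orthogonal to \<open>W\<close>.\<close>
  define z where "z = K (J u) + l *\<^sub>R u"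
  have "z \<in> W"
    unfolding z_def using W uW KW JW by (simp add: subspace_add subspace_scale)
  have "z \<bullet> z = K (J u) \<bullet> z + l * (u \<bullet> z)"
    by (simp add: z_def inner_add_left)
  also have "K (J u) \<bullet> z = - b u z"
    using form_symmetric[OF ut Wt[OF \<open>z \<in> W\<close>]] by (simp add: b_def K_skew[of "J u"] inner_commute[of _ "J u"])
  finally have "z = 0"
    using orth[OF \<open>z \<in> W\<close>] by simp
  then have "K z = 0"
    by (simp add: cross7.zero_right)
  then have Ju: "J u = l *\<^sub>R K u"
    using K_K[OF J_tangent[OF ut]] by (simp add: z_def cross7.add_right cross7.scaleR_right)
  moreover have "l \<noteq> 0"
  proof
    assume "l = 0"
    then have "J (J u) = 0"
      using Ju by (simp add: J_0)
    then show False
      using J_J[OF ut] uu by auto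
  qed
  ultimately show ?thesis
    using uW uu ut by (auto simp: eigen_def)
qed

text \<open>
  Orthogonality for the hermitian inner product of \<open>K\<close>.
\<close>

definition uorth :: "real^7 \<Rightarrow> real^7 \<Rightarrow> bool" where
  "uorth u v \<longleftrightarrow> u \<bullet> v = 0 \<and> u \<bullet> K v = 0"

lemma uorth_sym: "uorth u v \<Longrightarrow> uorth v u"
  unfolding uorth_def using inner_cross7_swap[of u y v] by (simp add: inner_commute)

lemma uorth_K: "u \<bullet> y = 0 \<Longrightarrow> uorth w u \<Longrightarrow> uorth (K w) u"
  unfolding uorth_def by (simp add: K_skew[of w] K_K)

lemma uorth_J:
  assumes u: "eigen u l" and w: "w \<bullet> y = 0" "uorth w u"
  shows "uorth (J w) u"
proof -
  have ut: "u \<bullet> y = 0" and l: "l \<noteq> 0" and Ju: "J u = l *\<^sub>R K u"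
    using u by (auto simp: eigen_def)
  have "K u \<bullet> J w = K w \<bullet> J u"
    by (rule form_symmetric[OF ut w(1)])
  also have "\<dots> = l * (w \<bullet> u)"
    using w by (simp add: Ju K_isometry)
  finally have 1: "J w \<bullet> K u = 0"
    using w by (simp add: inner_commute uorth_def)
  have "u \<bullet> J w = - (K (K u) \<bullet> J w)"
    by (simp add: K_K ut)
  also have "K (K u) \<bullet> J w = K w \<bullet> J (K u)"
    by (rule form_symmetric) (use w in auto)
  also have "\<dots> = (- 1 / l) * (K w \<bullet> u)"
    by (simp add: eigen_K[OF u])
  also have "K w \<bullet> u = 0"
    using w by (simp add: K_skew[of w] uorth_def)
  finally show ?thesis
    using 1 by (simp add: uorth_def inner_commute)
qed

lemma exists_eigen_uorth:
  assumes us: "\<forall>u\<in>set us. \<exists>l. eigen u l" and len: "length us \<le> 2"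
  shows "\<exists>w l. eigen w l \<and> (\<forall>u\<in>set us. uorth w u)"
proof -
  define W where "W = {w. w \<bullet> y = 0 \<and> (\<forall>u\<in>set us. uorth w u)}"
  have "subspace W"
    by (auto simp: subspace_def W_def uorth_def inner_add_left)
  have "length (y # us @ map K us) < DIM(real^7)"
    using len by simp
  then obtain v where "v \<noteq> 0" and "\<forall>x\<in>set (y # us @ map K us). v \<bullet> x = 0"
    using orthogonal_to_few_vectors by blast
  then have "v \<in> W"
    by (auto simp: W_def uorth_def)
  have "\<exists>u\<in>W. \<exists>l. eigen u l"
  proof (rule exists_eigen[OF \<open>subspace W\<close> _ \<open>v \<in> W\<close> \<open>v \<noteq> 0\<close>])
    show "W \<subseteq> {v. v \<bullet> y = 0}"
      by (auto simp: W_def)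
    show "K w \<in> W" if "w \<in> W" for w
      using that us uorth_K by (fastforce simp: W_def eigen_def)
    show "J w \<in> W" if "w \<in> W" for w
      using that us uorth_J J_tangent by (fastforce simp: W_def)
  qed
  then show ?thesis
    by (auto simp: W_def)
qed

lemma exists_eigenbasis:
  "\<exists>u1 u2 u3 l1 l2 l3. eigen u1 l1 \<and> eigen u2 l2 \<and> eigen u3 l3 \<and>
     uorth u1 u2 \<and> uorth u1 u3 \<and> uorth u2 u3"
proof -
  obtain u1 l1 where u1: "eigen u1 l1"
    using exists_eigen_uorth[of "[]"] by auto
  obtain u2 l2 where u2: "eigen u2 l2" "uorth u2 u1"
    using exists_eigen_uorth[of "[u1]"] u1 by auto
  obtain u3 l3 where u3: "eigen u3 l3" "uorth u3 u1" "uorth u3 u2"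
    using exists_eigen_uorth[of "[u1, u2]"] u1 u2 by auto
  show ?thesis
    using u1 u2 u3 uorth_sym by blast
qed

lemma eigenbasis_complete:
  assumes e: "eigen u1 l1" "eigen u2 l2" "eigen u3 l3" "uorth u1 u2" "uorth u1 u3" "uorth u2 u3"
    and v: "v \<bullet> y = 0" "uorth v u1" "uorth v u2" "uorth v u3"
  shows "v = 0"
proof (rule orthogonal_list_complete[of "[y, u1, K u1, u2, K u2, u3, K u3]"])
  note * = uorth_sym[OF e(4)] uorth_sym[OF e(5)] uorth_sym[OF e(6)]
  show "sorted_wrt (\<lambda>a b. a \<bullet> b = 0) [y, u1, K u1, u2, K u2, u3, K u3]"
    using e * by (auto simp: eigen_def uorth_def inner_commute[of y] K_isometry inner_commute)
  have "0 \<noteq> K u" "0 \<noteq> u" if "eigen u l" for u l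
    using that K_isometry[of u u] by (auto simp: eigen_def)
  from this[OF e(1)] this[OF e(2)] this[OF e(3)]
  show "0 \<notin> set [y, u1, K u1, u2, K u2, u3, K u3]"
    using unit by auto
  show "\<forall>x\<in>set [y, u1, K u1, u2, K u2, u3, K u3]. v \<bullet> x = 0"
    using v by (auto simp: uorth_def)
qed simp

text \<open>
  The 3-form takes the values \<open>c\<close> on \<open>u\<^sub>1, u\<^sub>2, u\<^sub>3\<close> and \<open>s\<close> on \<open>K u\<^sub>1, u\<^sub>2, u\<^sub>3\<close>, and by \<open>cross7_type\<close> these
  determine all its values on the basis.  Evaluated on the two triples, \<open>H\<close> says that multiples of \<open>c\<close> and
  \<open>s\<close> vanish, with factors that are positive if the \<open>l\<^sub>i\<close> have one sign.  Then \<open>u\<^sub>1 \<times> u\<^sub>2\<close> is orthogonal to everything.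
\<close>

lemma signs_differ:
  assumes e: "eigen u1 l1" "eigen u2 l2" "eigen u3 l3" "uorth u1 u2" "uorth u1 u3" "uorth u2 u3"
    and H: "\<And>u v w. u \<bullet> y = 0 \<Longrightarrow> v \<bullet> y = 0 \<Longrightarrow> w \<bullet> y = 0 \<Longrightarrow>
      cross7 u v \<bullet> w = cross7 (J u) (J v) \<bullet> w + cross7 (J u) v \<bullet> J w + cross7 u (J v) \<bullet> J w"
  shows "\<not> (l1 * l2 > 0 \<and> l1 * l3 > 0 \<and> l2 * l3 > 0)"
proof
  assume pos: "l1 * l2 > 0 \<and> l1 * l3 > 0 \<and> l2 * l3 > 0"
  have t: "u1 \<bullet> y = 0" "u2 \<bullet> y = 0" "u3 \<bullet> y = 0"
    and J: "J u1 = l1 *\<^sub>R K u1" "J u2 = l2 *\<^sub>R K u2" "J u3 = l3 *\<^sub>R K u3"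
    and l: "l1 \<noteq> 0" "l2 \<noteq> 0" "l3 \<noteq> 0" and n: "u1 \<bullet> u1 = 1" "u2 \<bullet> u2 = 1"
    using e by (auto simp: eigen_def)
  note JK = eigen_K[OF e(1)] eigen_K[OF e(2)] eigen_K[OF e(3)]
  define c where "c = cross7 u1 u2 \<bullet> u3"
  define s where "s = cross7 (K u1) u2 \<bullet> u3"
  have swap12: "cross7 (K u) v \<bullet> w = cross7 u (K v) \<bullet> w"
    if "u \<bullet> y = 0" "v \<bullet> y = 0" "w \<bullet> y = 0" for u v w
    using cross7_type[OF that] .
  have swap23: "cross7 u (K v) \<bullet> w = cross7 u v \<bullet> K w"
    if "u \<bullet> y = 0" "v \<bullet> y = 0" "w \<bullet> y = 0" for u v w
    using swap12[of v w u] that by (simp add: inner_cross7_cyclic[of u])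
  have c2: "cross7 (K u1) (K u2) \<bullet> u3 = - c" "cross7 (K u1) u2 \<bullet> K u3 = - c"
    "cross7 u1 (K u2) \<bullet> K u3 = - c"
    using swap12[of u1 "K u2" u3] swap23[of "K u1" u2 u3] swap12[of u1 u2 "K u3"] t
    by (auto simp: K_K c_def cross7.minus_right)
  have s1: "cross7 u1 (K u2) \<bullet> u3 = s" "cross7 u1 u2 \<bullet> K u3 = s"
    using swap12[of u1 u2 u3] swap23[of u1 u2 u3] t by (auto simp: s_def)
  have s3: "cross7 (K u1) (K u2) \<bullet> K u3 = - s"
    using swap12[of u1 "K u2" "K u3"] t by (simp add: K_K cross7.minus_right s1)
  have "c = (- (l1 * l2 + l1 * l3 + l2 * l3)) * c"
    using H[of u1 u2 u3] t
    by (simp add: J c2 cross7.scaleR_left cross7.scaleR_right c_def[symmetric] algebra_simps)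
  then have "(1 + l1 * l2 + l1 * l3 + l2 * l3) * c = 0"
    by (simp add: algebra_simps)
  then have c0: "c = 0"
    using pos by (smt (verit) mult_eq_0_iff)
  have "s = - (l2 / l1) * s - (l3 / l1) * s - (l2 * l3) * s"
    using H[of "K u1" u2 u3] t
    by (simp add: J JK s1 s3 cross7.scaleR_left cross7.scaleR_right s_def[symmetric] algebra_simps
        cross7.minus_left)
  then have "(1 + l2 / l1 + l3 / l1 + l2 * l3) * s = 0"
    by (simp add: algebra_simps)
  moreover have "l2 / l1 > 0" "l3 / l1 > 0"
    using pos by (auto simp: zero_less_divide_iff zero_less_mult_iff)
  ultimately have s0: "s = 0"
    using pos by (smt (verit) mult_eq_0_iff)
  have "cross7 u1 u2 = 0"
  proof (rule eigenbasis_complete[OF e])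
    have a: "cross7 u (K u) \<bullet> w = 0" if "u \<bullet> y = 0" "w \<bullet> y = 0" for u w
      using swap12[of u u w] that by (simp add: cross7_skew[of "K u" u])
    have "cross7 u1 u2 \<bullet> y = u2 \<bullet> K u1"
      by (metis inner_cross7_cyclic inner_commute)
    then show "cross7 u1 u2 \<bullet> y = 0"
      using uorth_sym[OF e(4)] by (simp add: uorth_def)
    have "cross7 u1 u2 \<bullet> K u1 = 0"
      using a[of u1 u2] t inner_cross7_cyclic[of "K u1" u1 u2] cross7_skew[of u1 "K u1"] by simp
    then show "uorth (cross7 u1 u2) u1"
      by (simp add: uorth_def)
    have "cross7 u1 u2 \<bullet> K u2 = 0"
      using a[of u2 u1] t inner_cross7_cyclic[of u1 u2 "K u2"] by simp
    then show "uorth (cross7 u1 u2) u2"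
      by (simp add: uorth_def)
    show "uorth (cross7 u1 u2) u3"
      using c0 s0 s1 by (simp add: uorth_def c_def)
  qed
  then have "0 = cross7 u1 u2 \<bullet> cross7 u1 u2"
    by simp
  also have "\<dots> = 1"
    using n e(4) unfolding norm_cross7 by (simp add: uorth_def)
  finally show False
    by simp
qed

text \<open>
  A \<open>K\<close>-complex linear map that has the eigenvalue \<open>l + 1 / l\<close> on the complex line of an eigenvector \<open>u\<close> with
  \<open>J u = l K u\<close>.  The number \<open>l\<close> itself is not an invariant of that line, since it becomes \<open>1 / l\<close> for \<open>K u\<close>.
\<close>

definition M :: "real^7 \<Rightarrow> real^7" where
  "M v = - (K (J v) + J (K v))"

text \<open>
  The quadratic form of \<open>M\<close>, written as the sum of the values of \<open>\<omega>(u, J u)\<close> at \<open>v\<close> and \<open>K v\<close>.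
\<close>

definition Q :: "real^7 \<Rightarrow> real" where
  "Q v = K v \<bullet> J v - J (K v) \<bullet> v"

lemma Q_M: "Q v = M v \<bullet> v"
  using inner_cross7_swap[of v y "J v"]
  by (simp add: Q_def M_def inner_diff_left inner_commute algebra_simps)

lemma linear_M: "linear M"
  unfolding M_def
  by (intro linear_compose_neg linear_compose_add)
    (auto intro!: linearI simp: J_add J_scale cross7.add_right cross7.scaleR_right)

lemmas M_add = linear_add[OF linear_M]
lemmas M_diff = linear_diff[OF linear_M]
lemmas M_scale = linear_scale[OF linear_M]

lemma M_eigen:
  assumes "eigen u l"
  shows "M u = (l + 1 / l) *\<^sub>R u" "M (K u) = (l + 1 / l) *\<^sub>R K u"
proof -
  have u: "J u = l *\<^sub>R K u" "K (K u) = - u" "l \<noteq> 0"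
    using assms K_K by (auto simp: eigen_def)
  then show "M u = (l + 1 / l) *\<^sub>R u"
    by (simp add: M_def eigen_K[OF assms] cross7.scaleR_right scaleR_add_left)
  show "M (K u) = (l + 1 / l) *\<^sub>R K u"
    using u by (simp add: M_def eigen_K[OF assms] cross7.scaleR_right cross7.minus_right J_scale
      linear_neg[OF linear_J] scaleR_add_left)
qed

lemma Q_eigen:
  assumes "eigen u l"
  shows "Q u = l + 1 / l"
  using assms unfolding Q_M M_eigen(1)[OF assms] by (simp add: eigen_def)

text \<open>
  The vector \<open>u\<close> is an eigenvector and spans the eigenline of \<open>M\<close> whose eigenvalue has the opposite sign to those of the other two.  As
  \<open>l + 1 / l\<close> is at least 2 in absolute value, the signs can be expressed by weak inequalities, which keeps the
  condition closed when \<open>y\<close> varies.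
\<close>

definition minority :: "real^7 \<Rightarrow> bool" where
  "minority u \<longleftrightarrow> u \<bullet> y = 0 \<and> u \<bullet> u = 1 \<and> J u = (K u \<bullet> J u) *\<^sub>R K u \<and>
     (\<exists>\<sigma>\<in>{1, -1}. \<sigma> * Q u \<le> - 2 \<and>
        (\<forall>v. v \<bullet> y = 0 \<and> uorth v u \<longrightarrow> 2 * (v \<bullet> v) \<le> \<sigma> * Q v))"

lemma sum_inverse_ge_2:
  fixes l :: real
  assumes "l > 0"
  shows "2 \<le> l + 1 / l"
proof -
  have "l + 1 / l - 2 = (l - 1)\<^sup>2 / l"
    using assms by (simp add: power2_eq_square divide_simps) (simp add: algebra_simps)
  then show ?thesis
    using assms by (metis diff_ge_0_iff_ge divide_nonneg_pos zero_le_power2)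
qed

lemma minorityI:
  assumes e: "eigen u1 l1" "eigen u2 l2" "eigen u3 l3" "uorth u1 u2" "uorth u1 u3" "uorth u2 u3"
    and \<sigma>: "\<sigma> = 1 \<or> \<sigma> = -1" "\<sigma> * l1 < 0" "\<sigma> * l2 > 0" "\<sigma> * l3 > 0"
  shows "minority u1"
proof -
  have m: "2 \<le> \<sigma> * (l + 1 / l)" if "\<sigma> * l > 0" for l
    using sum_inverse_ge_2[OF that] \<sigma>(1) by auto
  have "J u1 = (K u1 \<bullet> J u1) *\<^sub>R K u1"
    using e(1) K_isometry[of u1 u1] by (simp add: eigen_def)
  moreover have "\<sigma> * Q u1 \<le> - 2"
    using sum_inverse_ge_2[of "- (\<sigma> * l1)"] \<sigma>(1,2) by (auto simp: Q_eigen[OF e(1)])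
  moreover have "2 * (v \<bullet> v) \<le> \<sigma> * Q v" if v: "v \<bullet> y = 0" "uorth v u1" for v
  proof -
    define w where "w = v - (v \<bullet> u2) *\<^sub>R u2 - (v \<bullet> K u2) *\<^sub>R K u2 - (v \<bullet> u3) *\<^sub>R u3 - (v \<bullet> K u3) *\<^sub>R K u3"
    have n: "K u2 \<bullet> K u2 = 1" "K u3 \<bullet> K u3 = 1" "K u2 \<bullet> K u3 = 0" "K u3 \<bullet> K u2 = 0"
      "u2 \<bullet> u2 = 1" "u3 \<bullet> u3 = 1" "u2 \<bullet> u3 = 0" "u2 \<bullet> K u3 = 0" "u3 \<bullet> u2 = 0" "u3 \<bullet> K u2 = 0"
      "u2 \<bullet> y = 0" "u3 \<bullet> y = 0"
      using e uorth_sym[OF e(6)] K_isometry by (auto simp: eigen_def uorth_def)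
    note n' = uorth_sym[OF e(4)] uorth_sym[OF e(5)] e(4,5)
    have "w = 0"
    proof (rule eigenbasis_complete[OF e])
      show "w \<bullet> y = 0"
        using v n by (simp add: w_def inner_diff_left)
      show "uorth w u1"
        using v n n' e(1) K_isometry[of u2 u1] K_isometry[of u3 u1] K_skew[of u2 u1] K_skew[of u3 u1]
        by (simp add: w_def uorth_def inner_diff_left)
      show "uorth w u2" "uorth w u3"
        using n K_skew[of u2 u3] K_skew[of u3 u2]
        by (simp_all add: w_def uorth_def inner_diff_left)
    qed
    then have v_eq: "v = (v \<bullet> u2) *\<^sub>R u2 + (v \<bullet> K u2) *\<^sub>R K u2 + (v \<bullet> u3) *\<^sub>R u3 + (v \<bullet> K u3) *\<^sub>R K u3"
      by (simp add: w_def algebra_simps)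
    have vv: "v \<bullet> v = (v \<bullet> u2)\<^sup>2 + (v \<bullet> K u2)\<^sup>2 + (v \<bullet> u3)\<^sup>2 + (v \<bullet> K u3)\<^sup>2"
      using arg_cong[OF v_eq, of "\<lambda>x. v \<bullet> x"] by (simp add: inner_add_right power2_eq_square)
    have "Q v = M ((v \<bullet> u2) *\<^sub>R u2 + (v \<bullet> K u2) *\<^sub>R K u2 + (v \<bullet> u3) *\<^sub>R u3 + (v \<bullet> K u3) *\<^sub>R K u3) \<bullet> v"
      unfolding Q_M using v_eq by metis
    also have "\<dots> = (l2 + 1 / l2) * ((v \<bullet> u2)\<^sup>2 + (v \<bullet> K u2)\<^sup>2) + (l3 + 1 / l3) * ((v \<bullet> u3)\<^sup>2 + (v \<bullet> K u3)\<^sup>2)"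
      unfolding M_add M_scale M_eigen[OF e(2)] M_eigen[OF e(3)]
      by (simp add: inner_add_left inner_commute[of v] power2_eq_square algebra_simps)
    finally have "\<sigma> * Q v = (\<sigma> * (l2 + 1 / l2)) * ((v \<bullet> u2)\<^sup>2 + (v \<bullet> K u2)\<^sup>2)
        + (\<sigma> * (l3 + 1 / l3)) * ((v \<bullet> u3)\<^sup>2 + (v \<bullet> K u3)\<^sup>2)"
      by (simp add: ring_distribs)
    also have "\<dots> \<ge> 2 * ((v \<bullet> u2)\<^sup>2 + (v \<bullet> K u2)\<^sup>2) + 2 * ((v \<bullet> u3)\<^sup>2 + (v \<bullet> K u3)\<^sup>2)"
      by (intro add_mono mult_right_mono m \<sigma>) auto
    finally show ?thesis
      by (simp add: vv)
  qed
  ultimately show ?thesis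
    unfolding minority_def using e(1) \<sigma>(1) by (auto simp: eigen_def)
qed

lemma minority_exists:
  assumes H: "\<And>u v w. u \<bullet> y = 0 \<Longrightarrow> v \<bullet> y = 0 \<Longrightarrow> w \<bullet> y = 0 \<Longrightarrow>
      cross7 u v \<bullet> w = cross7 (J u) (J v) \<bullet> w + cross7 (J u) v \<bullet> J w + cross7 u (J v) \<bullet> J w"
  shows "\<exists>u. minority u"
proof -
  obtain u1 u2 u3 l1 l2 l3 where e: "eigen u1 l1" "eigen u2 l2" "eigen u3 l3"
    "uorth u1 u2" "uorth u1 u3" "uorth u2 u3"
    using exists_eigenbasis by blast
  note s = uorth_sym[OF e(4)] uorth_sym[OF e(5)] uorth_sym[OF e(6)]
  have nz: "l1 \<noteq> 0" "l2 \<noteq> 0" "l3 \<noteq> 0"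
    using e by (auto simp: eigen_def)
  have "\<exists>\<sigma>. (\<sigma> = 1 \<or> \<sigma> = -1) \<and>
     (\<sigma> * l1 < 0 \<and> \<sigma> * l2 > 0 \<and> \<sigma> * l3 > 0 \<or> \<sigma> * l2 < 0 \<and> \<sigma> * l1 > 0 \<and> \<sigma> * l3 > 0 \<or>
      \<sigma> * l3 < 0 \<and> \<sigma> * l1 > 0 \<and> \<sigma> * l2 > (0::real))"
  proof -
    have signs: "\<not> (l1 * l2 > 0 \<and> l1 * l3 > 0 \<and> l2 * l3 > 0)"
      by (rule signs_differ[OF e]) (rule H)
    have pos: "\<not> (l1 > 0 \<and> l2 > 0 \<and> l3 > 0)" and neg: "\<not> (l1 < 0 \<and> l2 < 0 \<and> l3 < 0)"
      using signs by (auto simp: mult_neg_neg)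
    show ?thesis
    proof (cases "(l1 > 0 \<and> l2 > 0) \<or> (l1 > 0 \<and> l3 > 0) \<or> (l2 > 0 \<and> l3 > 0)")
      case True
      then show ?thesis
        using pos nz by (intro exI[of _ 1]) (smt (verit))
    next
      case False
      then show ?thesis
        using neg nz by (intro exI[of _ "-1"]) (smt (verit))
    qed
  qed
  then show ?thesis
    using minorityI[OF e] minorityI[OF e(2,1,3) s(1) e(6,5)] minorityI[OF e(3,1,2) s(2,3) e(4)]
    by blast
qed

text \<open>
  If the two vectors belong to the same sign, the component of \<open>u'\<close> orthogonal to the complex line of \<open>u\<close> satisfies
  contradictory bounds on \<open>Q\<close> unless it vanishes.  If they belong to different signs, \<open>Q\<close> is definite of opposite signs on
  two subspaces of dimension 4 of the 6-dimensional tangent space, which must intersect.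
\<close>

lemma minority_line:
  assumes u: "minority u" and u': "minority u'"
  shows "u' = (u' \<bullet> u) *\<^sub>R u + (u' \<bullet> K u) *\<^sub>R K u"
proof -
  have eig: "\<exists>l. eigen u l" if u: "minority u" for u
  proof -
    have t: "u \<bullet> y = 0" "u \<bullet> u = 1" "J u = (K u \<bullet> J u) *\<^sub>R K u"
      using u by (auto simp: minority_def)
    have "K u \<bullet> J u \<noteq> 0"
    proof
      assume "K u \<bullet> J u = 0"
      then have "J (J u) = 0"
        using t(3) J_0 by simp
      then show False
        using J_J[OF t(1)] t(2) by auto
    qed
    then show ?thesis
      using t unfolding eigen_def by blast
  qed
  obtain l where l: "eigen u l" using eig[OF u] by blast
  obtain l' where l': "eigen u' l'" using eig[OF u'] by blast
  have t: "u \<bullet> y = 0" "u \<bullet> u = 1" "u' \<bullet> y = 0"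
    using l l' by (auto simp: eigen_def)
  obtain \<sigma> where \<sigma>: "\<sigma> = 1 \<or> \<sigma> = -1" "\<sigma> * Q u \<le> - 2"
    "\<And>v. v \<bullet> y = 0 \<Longrightarrow> uorth v u \<Longrightarrow> 2 * (v \<bullet> v) \<le> \<sigma> * Q v"
    using u unfolding minority_def by blast
  obtain \<sigma>' where \<sigma>': "\<sigma>' = 1 \<or> \<sigma>' = -1" "\<sigma>' * Q u' \<le> - 2"
    "\<And>v. v \<bullet> y = 0 \<Longrightarrow> uorth v u' \<Longrightarrow> 2 * (v \<bullet> v) \<le> \<sigma>' * Q v"
    using u' unfolding minority_def by blast
  have "\<sigma>' = \<sigma>"
  proof (rule ccontr)
    assume "\<sigma>' \<noteq> \<sigma>"
    then have neg: "\<sigma>' = - \<sigma>"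
      using \<sigma>(1) \<sigma>'(1) by auto
    have "length [y, u, K u, u', K u'] < DIM(real^7)"
      by simp
    then obtain v where v: "v \<noteq> 0" "\<forall>x\<in>set [y, u, K u, u', K u']. v \<bullet> x = 0"
      using orthogonal_to_few_vectors by blast
    then have "v \<bullet> y = 0" "uorth v u" "uorth v u'"
      by (auto simp: uorth_def)
    then have "2 * (v \<bullet> v) \<le> \<sigma> * Q v" "2 * (v \<bullet> v) \<le> - \<sigma> * Q v"
      using \<sigma>(3) \<sigma>'(3) neg by auto
    then have "v \<bullet> v \<le> 0"
      by simp
    then show False
      using v(1) inner_gt_zero_iff[of v] by linarith
  qed
  define a where "a = u' \<bullet> u"
  define b where "b = u' \<bullet> K u"
  define w where "w = u' - a *\<^sub>R u - b *\<^sub>R K u"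
  have Kuu: "K u \<bullet> K u = 1"
    using K_isometry t by simp
  have w: "w \<bullet> y = 0" "uorth w u"
    using t Kuu by (auto simp: w_def a_def b_def uorth_def inner_diff_left)
  have "u' \<bullet> w = w \<bullet> w"
  proof -
    have "w \<bullet> w = u' \<bullet> w - a * (u \<bullet> w) - b * (K u \<bullet> w)"
      by (simp add: w_def inner_diff_left)
    then show ?thesis
      using w(2) by (simp add: uorth_def inner_commute)
  qed
  then have "Q w = (l' + 1 / l') * (w \<bullet> w)"
    unfolding Q_M
    using w(2) by (subst (1) w_def)
      (simp add: M_diff M_scale M_eigen[OF l] M_eigen[OF l'] inner_diff_left inner_diff_right uorth_def inner_commute)
  then have "\<sigma> * Q w = (\<sigma> * Q u') * (w \<bullet> w)"
    using Q_eigen[OF l'] by simp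
  also have "\<dots> \<le> (-2) * (w \<bullet> w)"
    using \<sigma>'(2) \<open>\<sigma>' = \<sigma>\<close> by (intro mult_right_mono) auto
  finally have "w \<bullet> w \<le> 0"
    using \<sigma>(3)[OF w] by simp
  then have "w = 0"
    by (metis inner_gt_zero_iff not_less)
  then show ?thesis
    by (simp add: w_def a_def b_def algebra_simps)
qed

end

section \<open>Closedness and type\<close>

text \<open>
  The mean value theorem along \<open>a\<close> applied to the difference along \<open>b\<close>, and then along \<open>b\<close> applied to the derivative along \<open>a\<close>.
\<close>

lemma second_difference:
  fixes g :: "'a::real_normed_vector \<Rightarrow> real"
  assumes h: "h > 0" and W: "\<And>s t. 0 \<le> s \<Longrightarrow> s \<le> h \<Longrightarrow> 0 \<le> t \<Longrightarrow> t \<le> h \<Longrightarrow> z + s *\<^sub>R a + t *\<^sub>R b \<in> W"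
    and g': "\<And>x. x \<in> W \<Longrightarrow> (g has_derivative g' x) (at x)"
    and ga: "\<And>x. x \<in> W \<Longrightarrow> ((\<lambda>x. g' x a) has_derivative ga x) (at x)"
  shows "\<exists>s t. 0 \<le> s \<and> s \<le> h \<and> 0 \<le> t \<and> t \<le> h \<and>
    g (z + h *\<^sub>R a + h *\<^sub>R b) - g (z + h *\<^sub>R a) - (g (z + h *\<^sub>R b) - g z) =
      h * (h * ga (z + s *\<^sub>R a + t *\<^sub>R b) b)"
proof -
  define F where "F = (\<lambda>s. g (z + s *\<^sub>R a + h *\<^sub>R b) - g (z + s *\<^sub>R a + 0 *\<^sub>R b))"
  have deriv: "((\<lambda>s. k (p + s *\<^sub>R v)) has_real_derivative k' v) (at s)"
    if "(k has_derivative k') (at (p + s *\<^sub>R v))" for k k' v s and p :: 'a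
  proof -
    have "((\<lambda>s. p + s *\<^sub>R v) has_derivative (\<lambda>r. r *\<^sub>R v)) (at s)"
      by (auto intro!: derivative_eq_intros)
    then have "((\<lambda>s. k (p + s *\<^sub>R v)) has_derivative (\<lambda>r. k' (r *\<^sub>R v))) (at s)"
      using that by (rule has_derivative_compose)
    moreover have "k' (r *\<^sub>R v) = r * k' v" for r
      using linear_scale[OF has_derivative_linear[OF that]] by simp
    ultimately show ?thesis
      by (simp add: has_field_derivative_def mult.commute[of _ "k' v"] mult_commute_abs)
  qed
  have "DERIV F s :> g' (z + s *\<^sub>R a + h *\<^sub>R b) a - g' (z + s *\<^sub>R a + 0 *\<^sub>R b) a"
    if "0 \<le> s" "s \<le> h" for s
    unfolding F_def
  proof (rule DERIV_diff)
    have "((\<lambda>s. g ((z + t *\<^sub>R b) + s *\<^sub>R a)) has_real_derivative g' (z + s *\<^sub>R a + t *\<^sub>R b) a) (at s)"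
      if "0 \<le> t" "t \<le> h" for t
      using g'[OF W[OF \<open>0 \<le> s\<close> \<open>s \<le> h\<close> that]] by (intro deriv) (simp add: ac_simps)
    from this[of h] this[of 0] h
    show "((\<lambda>s. g (z + s *\<^sub>R a + h *\<^sub>R b)) has_real_derivative g' (z + s *\<^sub>R a + h *\<^sub>R b) a) (at s)"
      "((\<lambda>s. g (z + s *\<^sub>R a + 0 *\<^sub>R b)) has_real_derivative g' (z + s *\<^sub>R a + 0 *\<^sub>R b) a) (at s)"
      by (simp_all add: ac_simps)
  qed
  from MVT2[OF h this] obtain s where s: "0 < s" "s < h"
    "F h - F 0 = h * (g' (z + s *\<^sub>R a + h *\<^sub>R b) a - g' (z + s *\<^sub>R a + 0 *\<^sub>R b) a)"
    by auto
  have "DERIV (\<lambda>t. g' (z + s *\<^sub>R a + t *\<^sub>R b) a) t :> ga (z + s *\<^sub>R a + t *\<^sub>R b) b"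
    if "0 \<le> t" "t \<le> h" for t
    using ga[OF W[OF _ _ that]] s by (intro deriv) auto
  from MVT2[OF h this] obtain t where t: "0 < t" "t < h"
    "g' (z + s *\<^sub>R a + h *\<^sub>R b) a - g' (z + s *\<^sub>R a + 0 *\<^sub>R b) a = h * ga (z + s *\<^sub>R a + t *\<^sub>R b) b"
    by auto
  show ?thesis
    using s t by (intro exI[of _ s] exI[of _ t]) (simp add: F_def)
qed

text \<open>
  The second difference does not change when \<open>a\<close> and \<open>b\<close> are exchanged, so by \<open>second_difference\<close> the two mixed derivatives
  agree at points arbitrarily close to \<open>z\<close>.
\<close>

lemma second_derivative_symmetric_real:
  fixes g :: "'a::real_normed_vector \<Rightarrow> real"
  assumes W: "open W" "z \<in> W"
    and g': "\<And>x. x \<in> W \<Longrightarrow> (g has_derivative g' x) (at x)"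
    and ga: "\<And>x. x \<in> W \<Longrightarrow> ((\<lambda>x. g' x a) has_derivative ga x) (at x)"
    and gb: "\<And>x. x \<in> W \<Longrightarrow> ((\<lambda>x. g' x b) has_derivative gb x) (at x)"
    and cont: "continuous_on W (\<lambda>x. ga x b)" "continuous_on W (\<lambda>x. gb x a)"
  shows "ga z b = gb z a"
proof (rule ccontr)
  assume neq: "ga z b \<noteq> gb z a"
  define e where "e = \<bar>ga z b - gb z a\<bar> / 2"
  have "e > 0"
    using neq by (simp add: e_def)
  obtain d0 where d0: "d0 > 0" "ball z d0 \<subseteq> W"
    using W open_contains_ball by blast
  obtain d1 where d1: "d1 > 0" "\<And>x. x \<in> W \<Longrightarrow> dist x z < d1 \<Longrightarrow> dist (ga x b) (ga z b) < e"
    using cont(1) W(2) \<open>e > 0\<close> unfolding continuous_on_iff by metis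
  obtain d2 where d2: "d2 > 0" "\<And>x. x \<in> W \<Longrightarrow> dist x z < d2 \<Longrightarrow> dist (gb x a) (gb z a) < e"
    using cont(2) W(2) \<open>e > 0\<close> unfolding continuous_on_iff by metis
  define d where "d = min d0 (min d1 d2)"
  define h where "h = d / (2 * (norm a + norm b + 1))"
  have pos: "norm a + norm b + 1 > 0"
    using norm_ge_zero[of a] norm_ge_zero[of b] by linarith
  have h: "h > 0"
    using d0 d1 d2 pos by (simp add: h_def d_def)
  have close: "dist (z + s *\<^sub>R a + t *\<^sub>R b) z < d" if "0 \<le> s" "s \<le> h" "0 \<le> t" "t \<le> h" for s t
  proof -
    have "dist (z + s *\<^sub>R a + t *\<^sub>R b) z \<le> s * norm a + t * norm b"
      using that norm_triangle_ineq[of "s *\<^sub>R a" "t *\<^sub>R b"] by (simp add: dist_norm add.assoc)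
    also have "\<dots> \<le> h * norm a + h * norm b"
      using that by (intro add_mono mult_right_mono) auto
    also have "\<dots> < h * (2 * (norm a + norm b + 1))"
      using h norm_ge_zero[of a] norm_ge_zero[of b] by (simp add: algebra_simps add_nonneg_pos)
    also have "\<dots> = d"
      using pos by (simp add: h_def)
    finally show ?thesis .
  qed
  have inW: "z + s *\<^sub>R a + t *\<^sub>R b \<in> W" if "0 \<le> s" "s \<le> h" "0 \<le> t" "t \<le> h" for s t
    using close[OF that] d0 by (auto simp: d_def dist_commute)
  obtain s t where st: "0 \<le> s" "s \<le> h" "0 \<le> t" "t \<le> h"
    "g (z + h *\<^sub>R a + h *\<^sub>R b) - g (z + h *\<^sub>R a) - (g (z + h *\<^sub>R b) - g z) =
      h * (h * ga (z + s *\<^sub>R a + t *\<^sub>R b) b)"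
    using second_difference[OF h inW g' ga] by blast
  have "z + t *\<^sub>R b + s *\<^sub>R a \<in> W" if "0 \<le> s" "s \<le> h" "0 \<le> t" "t \<le> h" for s t
    using inW[OF that] by (simp add: ac_simps)
  from second_difference[OF h this g' gb] obtain s' t' where st': "0 \<le> s'" "s' \<le> h" "0 \<le> t'" "t' \<le> h"
    "g (z + h *\<^sub>R b + h *\<^sub>R a) - g (z + h *\<^sub>R b) - (g (z + h *\<^sub>R a) - g z) =
      h * (h * gb (z + s' *\<^sub>R b + t' *\<^sub>R a) a)"
    by blast
  have "h * (h * ga (z + s *\<^sub>R a + t *\<^sub>R b) b) = h * (h * gb (z + t' *\<^sub>R a + s' *\<^sub>R b) a)"
    unfolding st(5)[symmetric] using st'(5) by (simp add: ac_simps)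
  then have "ga (z + s *\<^sub>R a + t *\<^sub>R b) b = gb (z + t' *\<^sub>R a + s' *\<^sub>R b) a"
    using h by simp
  moreover have "dist (ga (z + s *\<^sub>R a + t *\<^sub>R b) b) (ga z b) < e"
    using inW[OF st(1-4)] close[OF st(1-4)] by (intro d1) (auto simp: d_def)
  moreover have "dist (gb (z + t' *\<^sub>R a + s' *\<^sub>R b) a) (gb z a) < e"
    using inW[OF st'(3,4,1,2)] close[OF st'(3,4,1,2)] by (intro d2) (auto simp: d_def)
  ultimately have "\<bar>ga z b - gb z a\<bar> < e + e"
    by (simp add: dist_real_def)
  then show False
    by (simp add: e_def)
qed

lemma C2_second_derivative:
  fixes f :: "'a::euclidean_space \<Rightarrow> 'b::euclidean_space"
  assumes W: "open W" "z \<in> W" and f: "Ck_on_open (Suc (Suc 0)) W f"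
  obtains f' f'' where "\<And>x. x \<in> W \<Longrightarrow> (f has_derivative f' x) (at x)"
    "\<And>a. ((\<lambda>x. f' x a) has_derivative f'' a) (at z)" "\<And>a b. f'' a b = f'' b a"
proof -
  define f' where "f' = (\<lambda>x. frechet_derivative f (at x))"
  define f'' where "f'' = (\<lambda>a x. frechet_derivative (\<lambda>x. f' x a) (at x))"
  have D: "(k has_derivative frechet_derivative k (at x)) (at x)"
    if "k differentiable_on W" "x \<in> W" for k :: "'a \<Rightarrow> 'b" and x
    using that W(1) by (simp add: frechet_derivative_works[symmetric] differentiable_on_eq_differentiable_at)
  have 1: "(f has_derivative f' x) (at x)" if "x \<in> W" for x
    unfolding f'_def using f that by (intro D) auto
  have 2: "((\<lambda>x. f' x a) has_derivative f'' a x) (at x)" if "x \<in> W" for x a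
    unfolding f'_def f''_def using f that by (intro D) auto
  have c: "continuous_on W (\<lambda>x. f'' a x b)" for a b
    using f by (simp add: f'_def f''_def)
  have "f'' a z b = f'' b z a" for a b
  proof (rule euclidean_eqI)
    fix e :: 'b assume "e \<in> Basis"
    have 1: "((\<lambda>x. f x \<bullet> e) has_derivative (\<lambda>v. f' x v \<bullet> e)) (at x)" if "x \<in> W" for x
      by (intro has_derivative_inner_left 1 that)
    have 2: "((\<lambda>x. f' x c \<bullet> e) has_derivative (\<lambda>v. f'' c x v \<bullet> e)) (at x)" if "x \<in> W" for x c
      by (intro has_derivative_inner_left 2 that)
    have c: "continuous_on W (\<lambda>x. f'' c x d \<bullet> e)" for c d
      by (intro continuous_intros c)
    show "f'' a z b \<bullet> e = f'' b z a \<bullet> e"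
      by (rule second_derivative_symmetric_real[OF W 1 2 2 c c])
  qed
  then show thesis
    using that[of f' "\<lambda>a. f'' a z"] 1 2[OF W(2)] by blast
qed

text \<open>
  Here \<open>w a b\<close> are the coefficients of the pullback of \<open>\<omega>\<close> along \<open>f\<close>, and \<open>D c a b\<close> are their derivatives in direction
  \<open>c\<close>.  The cyclic sum of \<open>D\<close> is the exterior derivative: the second derivatives of \<open>f\<close> cancel by symmetry, and three times
  the pullback of the octonionic 3-form remains.  As the pullback of \<open>\<omega>\<close> is invariant under the constant structure \<open>I\<close>, so are
  its derivatives, and the identity is the resulting vanishing of the components of type (3,0) and (0,3).
\<close>

lemma type_identity_of_closed_form:
  fixes f :: "'a::euclidean_space \<Rightarrow> real^7" and I :: "'a \<Rightarrow> 'a"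
  assumes W: "open W" "z \<in> W"
    and f': "\<And>x. x \<in> W \<Longrightarrow> (f has_derivative f' x) (at x)"
    and f'': "\<And>a. ((\<lambda>x. f' x a) has_derivative f'' a) (at z)"
    and sym: "\<And>a b. f'' a b = f'' b a"
    and I: "\<And>a. I (I a) = - a"
    and inv: "\<And>x a b. x \<in> W \<Longrightarrow> cross7 (f x) (f' x (I a)) \<bullet> f' x (I b) = cross7 (f x) (f' x a) \<bullet> f' x b"
  shows "cross7 (f' z a) (f' z b) \<bullet> f' z c =
    cross7 (f' z (I a)) (f' z (I b)) \<bullet> f' z c + cross7 (f' z (I a)) (f' z b) \<bullet> f' z (I c) +
    cross7 (f' z a) (f' z (I b)) \<bullet> f' z (I c)"
proof -
  define w where "w = (\<lambda>a b x. cross7 (f x) (f' x a) \<bullet> f' x b)"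
  define D where "D = (\<lambda>c a b. cross7 (f' z c) (f' z a) \<bullet> f' z b +
    cross7 (f z) (f'' a c) \<bullet> f' z b + cross7 (f z) (f' z a) \<bullet> f'' b c)"
  have der: "(w a b has_derivative (\<lambda>c. D c a b)) (at z)" for a b
    unfolding w_def D_def
    using has_derivative_inner[OF cross7.FDERIV[OF f'[OF W(2)] f''[of a]] f''[of b]]
    by (simp add: inner_add_left add_ac)
  have D_eq: "D c a b = r * D c a' b'" if "\<And>x. x \<in> W \<Longrightarrow> w a b x = r * w a' b' x" for a b a' b' c r
  proof -
    have "((\<lambda>x. r * w a' b' x) has_derivative (\<lambda>c. r * D c a' b')) (at z)"
      by (intro has_derivative_mult_right der)
    then have "(w a b has_derivative (\<lambda>c. r * D c a' b')) (at z)"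
      by (rule has_derivative_transform_within_open[OF _ W]) (simp add: that)
    from has_derivative_unique[OF der this] show ?thesis
      by (rule fun_cong)
  qed
  have neg: "f' x (- a) = - f' x a" if "x \<in> W" for x a
    using linear_neg[OF has_derivative_linear[OF f'[OF that]]] .
  have D1: "D c (I a) (I b) = D c a b" for a b c
    using D_eq[of "I a" "I b" 1 a b] inv by (simp add: w_def)
  \<comment> \<open>Invariance for the pair \<open>I a\<close>, \<open>b\<close>, since \<open>I (I a) = - a\<close>.\<close>
  have D2: "D c (I a) b = - D c a (I b)" for a b c
  proof -
    have "w (I a) b x = (-1) * w a (I b) x" if x: "x \<in> W" for x
      using inv[OF x, of "I a" b] by (simp add: w_def I neg[OF x] cross7.minus_right)
    from D_eq[OF this] show ?thesis by simp
  qed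
  have D3: "D c b a = - D c a b" for a b c
  proof -
    have "w b a x = (-1) * w a b x" for x
      using inner_cross7_skew[of "f x" "f' x b" "f' x a"] by (simp add: w_def inner_commute)
    from D_eq[OF this] show ?thesis by simp
  qed
  define \<Psi> where "\<Psi> = (\<lambda>a b c. D a b c + D b c a + D c a b)"
  have \<Psi>: "\<Psi> a b c = 3 * (cross7 (f' z a) (f' z b) \<bullet> f' z c)" for a b c
  proof -
    have 1: "cross7 (f' z b) (f' z c) \<bullet> f' z a = cross7 (f' z a) (f' z b) \<bullet> f' z c"
      "cross7 (f' z c) (f' z a) \<bullet> f' z b = cross7 (f' z a) (f' z b) \<bullet> f' z c"
      by (simp_all only: inner_cross7_cyclic[of "f' z a"] inner_cross7_cyclic[of "f' z c"])
    have 2: "cross7 (f z) u \<bullet> v = - (cross7 (f z) v \<bullet> u)" for u v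
      using inner_cross7_skew[of "f z" u v] by (simp add: inner_commute)
    show ?thesis
      unfolding \<Psi>_def D_def 1
      using 2[of "f'' b a" "f' z c"] 2[of "f'' c b" "f' z a"] 2[of "f'' a c" "f' z b"]
      by (simp add: sym[of b a] sym[of c b] sym[of a c])
  qed
  have "\<Psi> a b c = \<Psi> (I a) (I b) c + \<Psi> (I a) b (I c) + \<Psi> a (I b) (I c)"
    unfolding \<Psi>_def D1
    using D2[of "I a" b c] D2[of "I b" c a] D2[of "I c" a b] by simp
  then show ?thesis
    unfolding \<Psi> by simp
qed

text \<open>
  The derivatives of \<open>F\<close> and of the chart \<open>\<phi>\<close> are mutually inverse maps between \<open>\<complex>\<^sup>3\<close> and the tangent space.
\<close>

lemma chart_intertwines:
  assumes W: "open W" "z \<in> W" and F: "\<And>x. x \<in> W \<Longrightarrow> F x \<in> S6" "\<And>x. x \<in> W \<Longrightarrow> \<phi> (F x) = x"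
    and F': "(F has_derivative F') (at z)"
    and \<phi>': "(\<phi> has_derivative D) (at (F z) within S6)"
    and J: "\<And>v. v \<bullet> F z = 0 \<Longrightarrow> J v \<bullet> F z = 0"
    and D: "\<And>v. v \<bullet> F z = 0 \<Longrightarrow> D (J v) = \<i> *s D v"
  shows "J (F' a) = F' (\<i> *s a)" and "{v. v \<bullet> F z = 0} = range (F' :: complex^3 \<Rightarrow> real^7)"
proof -
  have d1: "((\<lambda>x. F x \<bullet> F x) has_derivative (\<lambda>a. F z \<bullet> F' a + F' a \<bullet> F z)) (at z)"
    by (intro has_derivative_inner F')
  have d2: "((\<lambda>x. F x \<bullet> F x) has_derivative (\<lambda>a. 0)) (at z)"
    by (rule has_derivative_transform_within_open[OF has_derivative_const[of 1] W])
      (use F(1) in \<open>simp add: S6_def norm_eq_1\<close>)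
  have "F z \<bullet> F' a + F' a \<bullet> F z = 0" for a
    using fun_cong[OF has_derivative_unique[OF d1 d2]] .
  then have tan: "F' a \<bullet> F z = 0" for a
    by (simp add: inner_commute)
  have "(\<phi> has_derivative D) (at (F z) within F ` W)"
    by (rule has_derivative_subset[OF \<phi>']) (use F(1) in blast)
  from has_derivative_in_compose[OF has_derivative_at_withinI[OF F'] this]
  have "((\<lambda>x. \<phi> (F x)) has_derivative (\<lambda>a. D (F' a))) (at z within W)" .
  then have "((\<lambda>x. \<phi> (F x)) has_derivative (\<lambda>a. D (F' a))) (at z)"
    by (simp only: at_within_open[OF W(2,1)])
  then have "((\<lambda>x. x) has_derivative (\<lambda>a. D (F' a))) (at z)"
    by (rule has_derivative_transform_within_open[OF _ W]) (rule F(2))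
  then have "(\<lambda>a. D (F' a)) = (\<lambda>a. a)"
    using has_derivative_ident by (rule has_derivative_unique)
  then have DF: "D (F' a) = a" for a
    by meson
  have lin: "linear F'"
    using F' by (rule has_derivative_linear)
  have "inj F'"
    by (rule injI) (metis DF)
  have "F z \<noteq> 0"
    using F(1)[OF W(2)] by (auto simp: S6_def)
  have "range F' = {v. F z \<bullet> v = 0}"
  proof (rule subspace_dim_equal)
    show "subspace (range F')"
      using lin by (simp add: linear_subspace_image)
    show "subspace {v. F z \<bullet> v = 0}"
      by (rule subspace_hyperplane)
    show "range F' \<subseteq> {v. F z \<bullet> v = 0}"
      using tan by (auto simp: inner_commute)
    have "dim (range F') = 6"
      using dim_image_eq[OF lin, of UNIV] \<open>inj F'\<close> by simp
    then show "dim {v. F z \<bullet> v = 0} \<le> dim (range F')"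
      using dim_hyperplane[OF \<open>F z \<noteq> 0\<close>] by simp
  qed
  then show range: "{v. v \<bullet> F z = 0} = range F'"
    by (simp add: inner_commute)
  obtain b where b: "J (F' a) = F' b"
    using J[OF tan[of a]] range by blast
  have "b = \<i> *s a"
    using D[OF tan[of a]] by (simp add: b DF)
  then show "J (F' a) = F' (\<i> *s a)"
    by (simp add: b)
qed

lemma integrable_type_identity:
  assumes int: "integrable_acs J"
    and J: "\<And>y v. y \<in> S6 \<Longrightarrow> v \<bullet> y = 0 \<Longrightarrow> J y v \<bullet> y = 0"
    and compat: "\<And>y u v. y \<in> S6 \<Longrightarrow> u \<bullet> y = 0 \<Longrightarrow> v \<bullet> y = 0 \<Longrightarrow>
      cross7 y (J y u) \<bullet> J y v = cross7 y u \<bullet> v"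
    and y: "y \<in> S6" and uvw: "u \<bullet> y = 0" "v \<bullet> y = 0" "w \<bullet> y = 0"
  shows "cross7 u v \<bullet> w = cross7 (J y u) (J y v) \<bullet> w + cross7 (J y u) v \<bullet> J y w + cross7 u (J y v) \<bullet> J y w"
proof -
  obtain A where A: "complex_atlas A" "induced_by_atlas A J"
    using int by (auto simp: integrable_acs_def)
  have "y \<in> (\<Union>(U, \<phi>)\<in>A. U)"
    using A(1) y by (simp add: complex_atlas_def)
  then obtain U \<phi> where U: "(U, \<phi>) \<in> A" "y \<in> U"
    by auto
  have chart: "smooth_chart U \<phi>"
    using A(1) U(1) by (auto simp: complex_atlas_def)
  then have US: "U \<subseteq> S6" and inj: "inj_on \<phi> U" and op: "open (\<phi> ` U)"
    and sm: "smooth_map_on (\<phi> ` U) (the_inv_into U \<phi>)"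
    using openin_imp_subset by (auto simp: smooth_chart_def)
  obtain V F where V: "open V" "\<phi> y \<in> V" and F: "\<And>k. Ck_on_open k V F"
    and F_eq: "\<And>x. x \<in> \<phi> ` U \<inter> V \<Longrightarrow> F x = the_inv_into U \<phi> x"
    using sm U(2) unfolding smooth_map_on_def by (metis image_eqI)
  define W where "W = \<phi> ` U \<inter> V"
  have W: "open W" "\<phi> y \<in> W"
    using op V U(2) by (auto simp: W_def)
  have FU: "F x \<in> U" "\<phi> (F x) = x" if "x \<in> W" for x
    using that F_eq[of x] inj by (auto simp: W_def the_inv_into_f_f)
  have Fy: "F (\<phi> y) = y"
    using F_eq[of "\<phi> y"] W U(2) inj by (simp add: W_def the_inv_into_f_f)
  obtain F' F'' where F': "\<And>x. x \<in> V \<Longrightarrow> (F has_derivative F' x) (at x)"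
    and F'': "\<And>a. ((\<lambda>x. F' x a) has_derivative F'' a) (at (\<phi> y))" and sym: "\<And>a b. F'' a b = F'' b a"
    using C2_second_derivative[OF V F] by metis
  have WV: "x \<in> V" if "x \<in> W" for x
    using that by (simp add: W_def)
  have JF: "J (F x) (F' x a) = F' x (\<i> *s a)" and T: "{v. v \<bullet> F x = 0} = range (F' x)"
    if x: "x \<in> W" for x a
  proof -
    have FS: "F x \<in> S6"
      using FU(1)[OF x] US by blast
    obtain D where D: "(\<phi> has_derivative D) (at (F x) within S6)"
      "\<forall>v\<in>tangent_S6 (F x). D (J (F x) v) = \<i> *s D v"
      using A(2) U(1) FU(1)[OF x] unfolding induced_by_atlas_def by blast
    have D': "D (J (F x) v) = \<i> *s D v" if "v \<bullet> F x = 0" for v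
      using D(2) that by (simp add: tangent_S6_def)
    have FS6: "F x \<in> S6" if "x \<in> W" for x
      using FU(1)[OF that] US by blast
    note * = chart_intertwines[OF W(1) x FS6 FU(2) F'[OF WV[OF x]] D(1) J[OF FS] D']
    show "J (F x) (F' x a) = F' x (\<i> *s a)"
      by (rule *(1))
    show "{v. v \<bullet> F x = 0} = range (F' x)"
      by (rule *(2))
  qed
  have tan: "F' x a \<bullet> F x = 0" if "x \<in> W" for x a
    using T[OF that] by blast
  obtain a b c where abc: "u = F' (\<phi> y) a" "v = F' (\<phi> y) b" "w = F' (\<phi> y) c"
    using T[OF W(2)] uvw unfolding Fy by blast
  have "cross7 (F' (\<phi> y) a) (F' (\<phi> y) b) \<bullet> F' (\<phi> y) c =
    cross7 (F' (\<phi> y) (\<i> *s a)) (F' (\<phi> y) (\<i> *s b)) \<bullet> F' (\<phi> y) c +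
    cross7 (F' (\<phi> y) (\<i> *s a)) (F' (\<phi> y) b) \<bullet> F' (\<phi> y) (\<i> *s c) +
    cross7 (F' (\<phi> y) a) (F' (\<phi> y) (\<i> *s b)) \<bullet> F' (\<phi> y) (\<i> *s c)"
  proof (rule type_identity_of_closed_form[OF W F'[OF WV] F'' sym])
    show "\<i> *s (\<i> *s a) = - a" for a :: "complex^3"
      by (simp add: vec_eq_iff vector_smult_assoc)
    show "cross7 (F x) (F' x (\<i> *s a)) \<bullet> F' x (\<i> *s b) = cross7 (F x) (F' x a) \<bullet> F' x b"
      if x: "x \<in> W" for x a b
      using compat[OF _ tan[OF x] tan[OF x], of a b] FU(1)[OF x] US by (auto simp: JF[OF x])
  qed
  then show ?thesis
    using JF[OF W(2)] by (simp add: abc Fy)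
qed

section \<open>Sections of complex line bundles over spheres\<close>

text \<open>
  The equator is the relative frontier of a ball of dimension at least 3.
\<close>

lemma equator_simply_connected:
  fixes c :: "'a::euclidean_space"
  assumes "c \<noteq> 0" "DIM('a) \<ge> 4"
  shows "simply_connected (sphere 0 1 \<inter> {x. c \<bullet> x = 0})"
    and "locally path_connected (sphere 0 1 \<inter> {x. c \<bullet> x = 0})"
proof -
  define T where "T = {x. c \<bullet> x = 0}"
  have aff: "affine T" and cvx: "convex T"
    by (auto simp: T_def affine_hyperplane convex_hyperplane)
  have 0: "0 \<in> T"
    by (simp add: T_def)
  have ne: "interior (cball 0 1) \<inter> T \<noteq> {}"
  proof -
    have "0 \<in> ball 0 1 \<inter> T"
      using 0 by simp
    then show ?thesis
      unfolding interior_cball by blast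
  qed
  have rf: "rel_frontier (cball 0 1 \<inter> T) = sphere 0 1 \<inter> T"
    by (subst convex_affine_rel_frontier_Int[OF convex_cball aff ne]) (simp add: frontier_cball)
  have "aff_dim (T \<inter> cball 0 1) = aff_dim T"
    using ne by (intro aff_dim_convex_Int_nonempty_interior[OF cvx]) auto
  then have dim: "3 \<le> aff_dim (cball 0 1 \<inter> T)"
    using assms by (simp add: Int_commute T_def aff_dim_hyperplane)
  show "simply_connected (sphere 0 1 \<inter> {x. c \<bullet> x = 0})"
    using simply_connected_sphere_gen[OF _ _ dim] cvx
    by (simp add: rf convex_Int bounded_Int flip: T_def)
  show "locally path_connected (sphere 0 1 \<inter> {x. c \<bullet> x = 0})"
    using locally_path_connected_sphere_gen[of "cball 0 1 \<inter> T"] cvx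
    by (simp add: rf convex_Int bounded_Int flip: T_def)
qed

text \<open>
  A family of complex lines over the unit sphere, given by a compact set \<open>E\<close> of unit vectors that contains a spanning vector of
  each line, though not necessarily all its unit vectors; \<open>K y\<close> acts on the line over \<open>y\<close> as multiplication by \<open>\<i>\<close>.
  Compactness of \<open>E\<close> makes the lines depend continuously on \<open>y\<close>.
\<close>

locale line_bundle =
  fixes K :: "'a::euclidean_space \<Rightarrow> 'b::euclidean_space \<Rightarrow> 'b"
    and E :: "('a \<times> 'b) set"
  assumes K: "bounded_bilinear K"
    and compact_E: "compact E"
    and base: "(y, u) \<in> E \<Longrightarrow> y \<in> sphere 0 1"
    and nonempty: "y \<in> sphere 0 1 \<Longrightarrow> \<exists>u. (y, u) \<in> E"
    and unit: "(y, u) \<in> E \<Longrightarrow> u \<bullet> u = 1"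
    and K_unit: "(y, u) \<in> E \<Longrightarrow> K y u \<bullet> K y u = 1"
    and K_orth: "(y, u) \<in> E \<Longrightarrow> u \<bullet> K y u = 0"
    and K_K: "(y, u) \<in> E \<Longrightarrow> K y (K y u) = - u"
    and line: "(y, u) \<in> E \<Longrightarrow> (y, v) \<in> E \<Longrightarrow> v = (v \<bullet> u) *\<^sub>R u + (v \<bullet> K y u) *\<^sub>R K y u"
begin

sublocale K: bounded_bilinear K by (rule K)

text \<open>
  The orthogonal projection onto the line over \<open>y\<close>; by \<open>line\<close> the choice of \<open>u\<close> does not matter.
\<close>

definition P :: "'a \<Rightarrow> 'b \<Rightarrow> 'b" where
  "P y v = (let u = SOME u. (y, u) \<in> E in (v \<bullet> u) *\<^sub>R u + (v \<bullet> K y u) *\<^sub>R K y u)"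

lemma P_eq:
  assumes E: "(y, u) \<in> E"
  shows "P y v = (v \<bullet> u) *\<^sub>R u + (v \<bullet> K y u) *\<^sub>R K y u"
proof -
  define w where "w = (SOME u. (y, u) \<in> E)"
  have w: "(y, w) \<in> E"
    unfolding w_def using E by (rule someI)
  define a where "a = w \<bullet> u"
  define b where "b = w \<bullet> K y u"
  have w_eq: "w = a *\<^sub>R u + b *\<^sub>R K y u"
    unfolding a_def b_def by (rule line[OF E w])
  have Kw: "K y w = a *\<^sub>R K y u - b *\<^sub>R u"
    by (simp add: w_eq K.add_right K.scaleR_right K_K[OF E])
  have "w \<bullet> w = a\<^sup>2 + b\<^sup>2"
    using K_orth[OF E]
    by (simp add: w_eq inner_add_left inner_add_right unit[OF E] K_unit[OF E] power2_eq_square inner_commute)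
  then have ab: "a\<^sup>2 + b\<^sup>2 = 1"
    using unit[OF w] by simp
  have "P y v = (v \<bullet> w) *\<^sub>R w + (v \<bullet> K y w) *\<^sub>R K y w"
    by (simp add: P_def w_def Let_def)
  also have "\<dots> = (a\<^sup>2 + b\<^sup>2) *\<^sub>R ((v \<bullet> u) *\<^sub>R u + (v \<bullet> K y u) *\<^sub>R K y u)"
    unfolding Kw unfolding w_eq
    by (simp add: inner_add_right inner_diff_right power2_eq_square algebra_simps)
  finally show ?thesis
    by (simp add: ab)
qed

lemma P_add: "P y (v + w) = P y v + P y w"
  by (simp add: P_def Let_def inner_add_left scaleR_add_left algebra_simps)

lemma P_scale: "P y (r *\<^sub>R v) = r *\<^sub>R P y v"
  by (simp add: P_def Let_def algebra_simps)

lemma linear_P: "linear (P y)"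
  by (intro linearI P_add P_scale)

lemma P_P:
  assumes "y \<in> sphere 0 1"
  shows "P y (P y v) = P y v"
proof -
  obtain u where u: "(y, u) \<in> E"
    using nonempty[OF assms] by blast
  have o: "u \<bullet> K y u = 0" "K y u \<bullet> u = 0"
    using K_orth[OF u] by (simp_all add: inner_commute)
  show ?thesis
    by (simp add: P_eq[OF u] inner_add_left unit[OF u] K_unit[OF u] o)
qed

lemma fibre_complex:
  assumes "y \<in> sphere 0 1" "P y v = v"
  shows "v \<bullet> K y v = 0" "K y v \<bullet> K y v = v \<bullet> v" "P y (K y v) = K y v" "K y (K y v) = - v"
proof -
  obtain u where u: "(y, u) \<in> E"
    using nonempty[OF assms(1)] by blast
  define a where "a = v \<bullet> u"
  define b where "b = v \<bullet> K y u"
  have v: "v = a *\<^sub>R u + b *\<^sub>R K y u"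
    using assms(2) by (simp add: P_eq[OF u] a_def b_def)
  have Kv: "K y v = a *\<^sub>R K y u - b *\<^sub>R u"
    by (simp add: v K.add_right K.scaleR_right K_K[OF u])
  have o: "u \<bullet> K y u = 0" "K y u \<bullet> u = 0"
    using K_orth[OF u] by (simp_all add: inner_commute)
  show "v \<bullet> K y v = 0" "K y v \<bullet> K y v = v \<bullet> v"
    unfolding Kv unfolding v
    by (simp_all add: inner_add_left inner_add_right inner_diff_left inner_diff_right o unit[OF u] K_unit[OF u])
  show "P y (K y v) = K y v"
    unfolding Kv by (simp add: P_eq[OF u] inner_diff_left o unit[OF u] K_unit[OF u])
  show "K y (K y v) = - v"
    unfolding Kv unfolding v by (simp add: K.diff_right K.scaleR_right K_K[OF u])
qed

lemma fibre_expand: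
  assumes y: "y \<in> sphere 0 1" and v: "P y v = v" and w: "P y w = w" "w \<noteq> 0"
  shows "v = ((v \<bullet> w) / (w \<bullet> w)) *\<^sub>R w + ((v \<bullet> K y w) / (w \<bullet> w)) *\<^sub>R K y w"
proof -
  obtain u where u: "(y, u) \<in> E"
    using nonempty[OF y] by blast
  have o: "u \<bullet> K y u = 0" "K y u \<bullet> u = 0"
    using K_orth[OF u] by (simp_all add: inner_commute)
  define a where "a = w \<bullet> u"
  define b where "b = w \<bullet> K y u"
  have w_eq: "w = a *\<^sub>R u + b *\<^sub>R K y u"
    using w(1) by (simp add: P_eq[OF u] a_def b_def)
  have Kw: "K y w = a *\<^sub>R K y u - b *\<^sub>R u"
    by (simp add: w_eq K.add_right K.scaleR_right K_K[OF u])
  have ww: "w \<bullet> w = a\<^sup>2 + b\<^sup>2"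
    by (simp add: w_eq inner_add_left inner_add_right o unit[OF u] K_unit[OF u] power2_eq_square)
  have "(v \<bullet> w) *\<^sub>R w + (v \<bullet> K y w) *\<^sub>R K y w = (a\<^sup>2 + b\<^sup>2) *\<^sub>R ((v \<bullet> u) *\<^sub>R u + (v \<bullet> K y u) *\<^sub>R K y u)"
    unfolding Kw unfolding w_eq
    by (simp add: inner_add_right inner_diff_right power2_eq_square algebra_simps)
  also have "\<dots> = (w \<bullet> w) *\<^sub>R v"
    using v by (simp add: ww P_eq[OF u])
  finally have *: "(w \<bullet> w) *\<^sub>R v = (v \<bullet> w) *\<^sub>R w + (v \<bullet> K y w) *\<^sub>R K y w" ..
  have "v = (1 / (w \<bullet> w)) *\<^sub>R ((w \<bullet> w) *\<^sub>R v)"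
    using w(2) by simp
  then show ?thesis
    unfolding * by (simp add: scaleR_add_right)
qed

text \<open>
  The graph is a continuous image of the compact set \<open>E\<close>.
\<close>

lemma continuous_P: "continuous_on (sphere 0 1) (\<lambda>y. P y v)"
proof (rule continuous_from_closed_graph)
  show "compact (cball 0 (2 * norm v) :: 'b set)"
    by simp
  show "(\<lambda>y. P y v) \<in> sphere 0 1 \<rightarrow> cball 0 (2 * norm v)"
  proof
    fix y :: 'a assume "y \<in> sphere 0 1"
    then obtain u where u: "(y, u) \<in> E"
      using nonempty by blast
    have n: "norm u = 1" "norm (K y u) = 1"
      using unit[OF u] K_unit[OF u] by (simp_all add: norm_eq_sqrt_inner)
    have "norm (P y v) \<le> \<bar>v \<bullet> u\<bar> + \<bar>v \<bullet> K y u\<bar>"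
      unfolding P_eq[OF u] by (rule order_trans[OF norm_triangle_ineq]) (simp add: n)
    also have "\<dots> \<le> 2 * norm v"
      using Cauchy_Schwarz_ineq2[of v u] Cauchy_Schwarz_ineq2[of v "K y u"] by (simp add: n)
    finally show "P y v \<in> cball 0 (2 * norm v)"
      by simp
  qed
  have "(\<lambda>y. (y, P y v)) ` sphere 0 1 =
      (\<lambda>(y, u). (y, (v \<bullet> u) *\<^sub>R u + (v \<bullet> K y u) *\<^sub>R K y u)) ` E"
  proof (intro equalityI subsetI)
    fix z assume "z \<in> (\<lambda>y. (y, P y v)) ` sphere 0 1"
    then obtain y where y: "y \<in> sphere 0 1" "z = (y, P y v)"
      by blast
    obtain u where u: "(y, u) \<in> E"
      using nonempty[OF y(1)] by blast
    show "z \<in> (\<lambda>(y, u). (y, (v \<bullet> u) *\<^sub>R u + (v \<bullet> K y u) *\<^sub>R K y u)) ` E"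
      by (rule image_eqI[OF _ u]) (simp add: y P_eq[OF u])
  next
    fix z assume "z \<in> (\<lambda>(y, u). (y, (v \<bullet> u) *\<^sub>R u + (v \<bullet> K y u) *\<^sub>R K y u)) ` E"
    then obtain y u where u: "(y, u) \<in> E" "z = (y, (v \<bullet> u) *\<^sub>R u + (v \<bullet> K y u) *\<^sub>R K y u)"
      by auto
    then show "z \<in> (\<lambda>y. (y, P y v)) ` sphere 0 1"
      using base[OF u(1)] by (intro image_eqI[of _ _ y]) (simp_all add: P_eq[OF u(1)])
  qed
  moreover have "compact ((\<lambda>(y, u). (y, (v \<bullet> u) *\<^sub>R u + (v \<bullet> K y u) *\<^sub>R K y u)) ` E)"
    unfolding split_beta
    by (intro compact_continuous_image compact_E continuous_intros K.continuous_on)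
  ultimately show "closed ((\<lambda>y. (y, P y v)) ` sphere 0 1)"
    by (simp add: compact_imp_closed)
qed

lemma continuous_on_P:
  assumes "continuous_on X f" "continuous_on X g" "\<And>x. x \<in> X \<Longrightarrow> f x \<in> sphere 0 1"
  shows "continuous_on X (\<lambda>x. P (f x) (g x))"
proof -
  have "P y v = (\<Sum>b\<in>Basis. (v \<bullet> b) *\<^sub>R P y b)" for y v
    by (metis (mono_tags, lifting) euclidean_representation linear_P linear_sum P_scale sum.cong)
  then have eq: "(\<lambda>x. P (f x) (g x)) = (\<lambda>x. \<Sum>b\<in>Basis. (g x \<bullet> b) *\<^sub>R P (f x) b)"
    by blast
  have "continuous_on X (\<lambda>x. P (f x) b)" for b
    by (rule continuous_on_compose2[OF continuous_P assms(1)]) (use assms(3) in auto)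
  then show ?thesis
    unfolding eq by (intro continuous_intros assms)
qed

text \<open>
  A vector over the centre \<open>c\<close> is transported along the great circles that start at \<open>c\<close>.  Transport is projection to the next
  fibre; by uniform continuity of \<open>P\<close>, sufficiently short steps never send a nonzero vector to 0.
\<close>

lemma section_over_hemisphere:
  assumes c: "c \<in> sphere 0 1" and X: "compact X" "X \<subseteq> sphere 0 1" "\<And>x. x \<in> X \<Longrightarrow> x \<bullet> c \<ge> 0"
  shows "\<exists>s. continuous_on X s \<and> (\<forall>x\<in>X. s x \<noteq> 0 \<and> P x (s x) = s x)"
proof -
  define \<gamma> where "\<gamma> = (\<lambda>t x. (1 - t) *\<^sub>R c + t *\<^sub>R x)"
  define g where "g = (\<lambda>t x. \<gamma> t x /\<^sub>R norm (\<gamma> t x))"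
  have \<gamma>_nz: "\<gamma> t x \<noteq> 0" if "t \<in> {0..1}" "x \<in> X" for t x
  proof -
    have "x \<bullet> x = 1" "c \<bullet> c = 1"
      using X c that by (auto simp: dot_square_norm)
    then have "\<gamma> t x \<bullet> \<gamma> t x = (1 - t)\<^sup>2 + t\<^sup>2 + 2 * (t * (1 - t) * (x \<bullet> c))"
      by (simp add: \<gamma>_def inner_add_left inner_add_right power2_eq_square inner_commute algebra_simps)
    moreover have "0 \<le> t * (1 - t) * (x \<bullet> c)"
      using that X by (intro mult_nonneg_nonneg) auto
    moreover have "(1 - t)\<^sup>2 + t\<^sup>2 > 0"
      by (simp add: sum_power2_gt_zero_iff)
    ultimately show ?thesis
      by auto
  qed
  have g_sphere: "g t x \<in> sphere 0 1" if "t \<in> {0..1}" "x \<in> X" for t x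
    using \<gamma>_nz[OF that] by (simp add: g_def)
  have g_cont: "continuous_on ({0..1} \<times> X) (\<lambda>(t, x). g t x)"
  proof -
    have "continuous_on ({0..1} \<times> X) (\<lambda>z. \<gamma> (fst z) (snd z))"
      unfolding \<gamma>_def by (intro continuous_intros)
    moreover have "\<forall>z\<in>{0..1} \<times> X. norm (\<gamma> (fst z) (snd z)) \<noteq> 0"
      using \<gamma>_nz by (metis SigmaE fst_conv norm_eq_zero snd_conv)
    ultimately have "continuous_on ({0..1} \<times> X) (\<lambda>z. inverse (norm (\<gamma> (fst z) (snd z))))"
      by (intro continuous_on_inverse continuous_on_norm)
    from continuous_on_scaleR[OF this \<open>continuous_on _ (\<lambda>z. \<gamma> (fst z) (snd z))\<close>]
    show ?thesis
      by (simp add: g_def split_beta)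
  qed
  have g0: "g 0 x = c" for x
    using c by (simp add: g_def \<gamma>_def)
  have g1: "g 1 x = x" if "x \<in> X" for x
    using X that by (auto simp: g_def \<gamma>_def)
  \<comment> \<open>Only unit vectors are needed, since projection is linear; this makes the domain compact.\<close>
  define C where "C = {0..1::real} \<times> X \<times> sphere (0::'b) 1"
  define G where "G = (\<lambda>(t, x, v). P (g t x) v)"
  have "compact C"
    unfolding C_def using X by (intro compact_Times) auto
  moreover have "continuous_on C G"
    unfolding G_def split_beta C_def
  proof (rule continuous_on_P)
    have "continuous_on ({0..1} \<times> X \<times> sphere (0::'b) 1) (\<lambda>z. (\<lambda>(t, x). g t x) (fst z, fst (snd z)))"
      by (rule continuous_on_compose2[OF g_cont]) (auto intro!: continuous_intros)
    then show "continuous_on ({0..1} \<times> X \<times> sphere (0::'b) 1) (\<lambda>z. g (fst z) (fst (snd z)))"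
      by simp
  qed (use g_sphere in \<open>auto intro!: continuous_intros\<close>)
  ultimately have "uniformly_continuous_on C G"
    by (intro compact_uniformly_continuous)
  then obtain d where d: "d > 0" "\<And>p q. p \<in> C \<Longrightarrow> q \<in> C \<Longrightarrow> dist q p < d \<Longrightarrow> dist (G q) (G p) < 1"
    unfolding uniformly_continuous_on_def by (metis zero_less_one)
  obtain k where "inverse (real (Suc k)) < d"
    using reals_Archimedean[OF d(1)] by blast
  then obtain N :: nat where N: "N > 0" "1 / real N < d"
    by (metis inverse_eq_divide zero_less_Suc)
  have "\<exists>s. continuous_on X s \<and> (\<forall>x\<in>X. s x \<noteq> 0 \<and> P (g (real n / real N) x) (s x) = s x)" if "n \<le> N" for n
    using that
  proof (induction n)
    case 0
    obtain u where u: "(c, u) \<in> E"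
      using nonempty[OF c] by blast
    have "P c u = u"
      using K_orth[OF u] by (simp add: P_eq[OF u] unit[OF u])
    moreover have "u \<noteq> 0"
      using unit[OF u] by auto
    ultimately show ?case
      by (intro exI[of _ "\<lambda>_. u"]) (auto simp: g0)
  next
    case (Suc n)
    then obtain s where s: "continuous_on X s"
      "\<And>x. x \<in> X \<Longrightarrow> s x \<noteq> 0" "\<And>x. x \<in> X \<Longrightarrow> P (g (real n / real N) x) (s x) = s x"
      by (metis Suc_leD)
    define t where "t = real n / real N"
    define t' where "t' = real (Suc n) / real N"
    have t: "t \<in> {0..1}" "t' \<in> {0..1}" "\<bar>t' - t\<bar> < d"
      using Suc.prems N by (auto simp: t_def t'_def divide_simps)
    define s' where "s' = (\<lambda>x. P (g t' x) (s x))"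
    have "continuous_on X (\<lambda>x. g t' x)"
    proof -
      have "continuous_on X (\<lambda>x. (\<lambda>(t, x). g t x) (t', x))"
        by (rule continuous_on_compose2[OF g_cont]) (use t in \<open>auto intro!: continuous_intros\<close>)
      then show ?thesis
        by simp
    qed
    then have "continuous_on X s'"
      unfolding s'_def using s(1) g_sphere[OF t(2)] by (rule continuous_on_P)
    moreover have "s' x \<noteq> 0" if x: "x \<in> X" for x
    proof
      assume "s' x = 0"
      define v where "v = s x /\<^sub>R norm (s x)"
      have v: "norm v = 1"
        using s(2)[OF x] by (simp add: v_def)
      have "G (t, x, v) = v"
        using s(3)[OF x] by (simp add: G_def v_def P_scale t_def)
      moreover have "G (t', x, v) = 0"
        using \<open>s' x = 0\<close> by (simp add: G_def v_def P_scale s'_def)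
      moreover have "dist (G (t', x, v)) (G (t, x, v)) < 1"
        using t x v by (intro d(2)) (auto simp: C_def dist_Pair_Pair dist_real_def)
      ultimately show False
        using v by simp
    qed
    moreover have "P (g t' x) (s' x) = s' x" if "x \<in> X" for x
      unfolding s'_def by (rule P_P[OF g_sphere[OF t(2) that]])
    ultimately show ?case
      unfolding t'_def by blast
  qed
  from this[OF order_refl] show ?thesis
    using N(1) by (auto simp: g1)
qed

text \<open>
  Over the equator the two sections differ by a nonvanishing complex function.  Its logarithm extends to the whole
  sphere, so one of the sections can be corrected to fit the other.
\<close>

theorem section_exists:
  assumes "DIM('a) \<ge> 4"
  shows "\<exists>s. continuous_on (sphere 0 1) s \<and> (\<forall>y\<in>sphere 0 1. s y \<noteq> 0 \<and> P y (s y) = s y)"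
proof -
  obtain c :: 'a where "c \<in> Basis"
    using nonempty_Basis by blast
  then have c: "c \<in> sphere 0 1" "- c \<in> sphere 0 1" "c \<noteq> 0"
    by auto
  define U where "U = sphere 0 1 \<inter> {x. x \<bullet> c \<ge> 0}"
  define L where "L = sphere 0 1 \<inter> {x. x \<bullet> c \<le> 0}"
  define Eq where "Eq = sphere 0 1 \<inter> {x. c \<bullet> x = 0}"
  have cl: "compact U" "compact L"
    unfolding U_def L_def
    by (auto intro!: compact_Int_closed closed_Collect_le continuous_intros)
  have "\<exists>s. continuous_on U s \<and> (\<forall>x\<in>U. s x \<noteq> 0 \<and> P x (s x) = s x)"
    by (rule section_over_hemisphere[OF c(1) cl(1)]) (simp_all add: U_def)
  then obtain s1 where s1: "continuous_on U s1" "\<And>x. x \<in> U \<Longrightarrow> s1 x \<noteq> 0" "\<And>x. x \<in> U \<Longrightarrow> P x (s1 x) = s1 x"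
    by metis
  have "\<exists>s. continuous_on L s \<and> (\<forall>x\<in>L. s x \<noteq> 0 \<and> P x (s x) = s x)"
    by (rule section_over_hemisphere[OF c(2) cl(2)]) (simp_all add: L_def)
  then obtain s2 where s2: "continuous_on L s2" "\<And>x. x \<in> L \<Longrightarrow> s2 x \<noteq> 0" "\<And>x. x \<in> L \<Longrightarrow> P x (s2 x) = s2 x"
    by metis
  \<comment> \<open>Complex numbers act on the fibres through \<open>m\<close>, and \<open>f\<close> is the quotient of \<open>s1\<close> by \<open>s2\<close>.\<close>
  define f where "f = (\<lambda>y. Complex ((s1 y \<bullet> s2 y) / (s2 y \<bullet> s2 y)) ((s1 y \<bullet> K y (s2 y)) / (s2 y \<bullet> s2 y)))"
  define m where "m = (\<lambda>z y v. Re z *\<^sub>R v + Im z *\<^sub>R K y v)"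
  have sub: "Eq \<subseteq> U" "Eq \<subseteq> L" "Eq \<subseteq> sphere 0 1" "U \<subseteq> sphere 0 1" "L \<subseteq> sphere 0 1"
    by (auto simp: Eq_def U_def L_def inner_commute)
  have f: "m (f y) y (s2 y) = s1 y" if "y \<in> Eq" for y
  proof -
    have "y \<in> sphere 0 1" "y \<in> U" "y \<in> L"
      using that sub by blast+
    from fibre_expand[OF this(1) s1(3)[OF this(2)] s2(3)[OF this(3)] s2(2)[OF this(3)]]
    show ?thesis
      by (simp add: m_def f_def)
  qed
  have s_Eq: "continuous_on Eq s1" "continuous_on Eq s2"
    using s1(1) s2(1) sub by (blast intro: continuous_on_subset)+
  have "\<forall>y\<in>Eq. s2 y \<bullet> s2 y \<noteq> 0"
    using s2(2) sub(2) by (simp add: subset_iff)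
  then have f_cont: "continuous_on Eq f"
    unfolding f_def Complex_eq by (intro continuous_intros K.continuous_on s_Eq) auto
  have f_nz: "f y \<noteq> 0" if "y \<in> Eq" for y
  proof
    assume "f y = 0"
    then have "s1 y = 0"
      using f[OF that] by (simp add: m_def)
    then show False
      using s1(2)[of y] sub(1) that by blast
  qed
  have sc: "simply_connected Eq" "locally path_connected Eq"
    unfolding Eq_def by (rule equator_simply_connected[OF c(3) assms])+
  obtain h where h: "continuous_on Eq h" "\<And>y. y \<in> Eq \<Longrightarrow> f y = exp (h y)"
    using continuous_logarithm_on_simply_connected[OF f_cont sc f_nz] by metis
  have "closedin (top_of_set (sphere 0 1)) Eq"
    unfolding Eq_def by (intro closedin_closed_Int closed_hyperplane)
  then obtain H where H: "continuous_on (sphere 0 1) H" "\<And>y. y \<in> Eq \<Longrightarrow> H y = h y"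
    using Dugundji[OF convex_UNIV _ _ h(1), of "sphere 0 1"] by (metis UNIV_not_empty subset_UNIV)
  define s where "s = (\<lambda>y. if y \<bullet> c \<ge> 0 then s1 y else m (exp (H y)) y (s2 y))"
  have "continuous_on (U \<union> L) s"
    unfolding s_def
  proof (rule continuous_on_cases)
    show "continuous_on L (\<lambda>y. m (exp (H y)) y (s2 y))"
      unfolding m_def using continuous_on_subset[OF H(1) sub(5)] s2(1)
      by (intro continuous_intros K.continuous_on)
    show "\<forall>y. y \<in> U \<and> \<not> y \<bullet> c \<ge> 0 \<or> y \<in> L \<and> y \<bullet> c \<ge> 0 \<longrightarrow> s1 y = m (exp (H y)) y (s2 y)"
    proof (intro allI impI)
      fix y assume "y \<in> U \<and> \<not> y \<bullet> c \<ge> 0 \<or> y \<in> L \<and> y \<bullet> c \<ge> 0"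
      then have "y \<in> Eq"
        by (auto simp: U_def L_def Eq_def inner_commute)
      then show "s1 y = m (exp (H y)) y (s2 y)"
        using f H(2) h(2) by simp
    qed
  qed (use cl s1 in \<open>auto intro: compact_imp_closed\<close>)
  moreover have "U \<union> L = sphere 0 1"
    by (auto simp: U_def L_def)
  moreover have "s y \<noteq> 0 \<and> P y (s y) = s y" if y: "y \<in> sphere 0 1" for y
  proof (cases "y \<bullet> c \<ge> 0")
    case True
    then show ?thesis
      using s1 y by (auto simp: s_def U_def)
  next
    case False
    then have "y \<in> L"
      using y by (auto simp: L_def)
    note L = s2(2)[OF this] fibre_complex[OF y s2(3)[OF this]] s2(3)[OF this]
    define z where "z = exp (H y)"
    have "m z y (s2 y) \<bullet> m z y (s2 y) = ((Re z)\<^sup>2 + (Im z)\<^sup>2) * (s2 y \<bullet> s2 y)"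
      using L by (simp add: m_def inner_add_left inner_add_right power2_eq_square inner_commute algebra_simps)
    moreover have "(Re z)\<^sup>2 + (Im z)\<^sup>2 > 0"
      unfolding z_def by (metis cmod_power2 exp_not_eq_zero norm_eq_zero zero_less_power2)
    ultimately have "m z y (s2 y) \<noteq> 0"
      using L(1) by auto
    moreover have "P y (m z y (s2 y)) = m z y (s2 y)"
      using L by (simp add: m_def P_add P_scale)
    ultimately show ?thesis
      using False by (simp add: s_def z_def)
  qed
  ultimately show ?thesis
    by metis
qed

end

section \<open>Nonvanishing vector fields on the six-sphere\<close>

definition nsphere_to_S6 :: "(nat \<Rightarrow> real) \<Rightarrow> real^7" where
  "nsphere_to_S6 x = vector [x 0, x 1, x 2, x 3, x 4, x 5, x 6]"

definition S6_to_nsphere :: "real^7 \<Rightarrow> nat \<Rightarrow> real" where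
  "S6_to_nsphere v = (\<lambda>i. if i < 7 then v $ of_nat (Suc i) else 0)"

text \<open>
  The degree theory lives on \<open>nsphere 6\<close>, a set of real sequences; the next lemmas transfer it to \<open>S6\<close>.
\<close>

lemma nsphere_6: "nsphere 6 = top_of_set {x. (\<forall>i\<ge>7. x i = 0) \<and> (\<Sum>i\<le>6. (x i)\<^sup>2) = 1}"
  by (simp add: nsphere_def Euclidean_space_def euclidean_product_topology subtopology_subtopology
      Collect_conj_eq)

lemma less_7_cases: "i < (7::nat) \<Longrightarrow> i = 0 \<or> i = 1 \<or> i = 2 \<or> i = 3 \<or> i = 4 \<or> i = 5 \<or> i = 6"
  by linarith

lemma S6_to_nsphere_mem_to_S6: "x \<in> topspace (nsphere 6) \<Longrightarrow> S6_to_nsphere (nsphere_to_S6 x) = x"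
  by (rule ext) (auto simp: nsphere_6 S6_to_nsphere_def nsphere_to_S6_def dest!: less_7_cases)

lemma sum_atMost_6: "(\<Sum>i\<le>(6::nat). f i) = f 0 + f 1 + f 2 + f 3 + f 4 + f 5 + (f 6 :: real)"
  by (simp add: numeral_eq_Suc)

lemma nsphere_to_S6_mem: "x \<in> topspace (nsphere 6) \<Longrightarrow> nsphere_to_S6 x \<in> S6"
  by (simp add: nsphere_6 S6_def nsphere_to_S6_def norm_eq_1 inner_7 sum_atMost_6 power2_eq_square)

lemma S6_to_nsphere_mem: "v \<in> S6 \<Longrightarrow> S6_to_nsphere v \<in> topspace (nsphere 6)"
  by (simp add: nsphere_6 S6_def S6_to_nsphere_def norm_eq_1 inner_7 sum_atMost_6 power2_eq_square)

lemma continuous_S6_to_nsphere: "continuous_on X S6_to_nsphere"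
  unfolding S6_to_nsphere_def
proof (rule continuous_on_coordinatewise_then_product)
  show "continuous_on X (\<lambda>v::real^7. if i < 7 then v $ of_nat (Suc i) else 0)" for i
    by (cases "i < 7") (simp_all add: continuous_intros)
qed

lemma continuous_nsphere_to_S6: "continuous_on X nsphere_to_S6"
proof (subst continuous_on_componentwise, intro ballI)
  have *: "continuous_on X (\<lambda>x. nsphere_to_S6 x $ j)" for j
  proof -
    have "continuous_on X (\<lambda>x::nat \<Rightarrow> real. x i)" for i
      by (rule continuous_on_subset[OF continuous_on_product_coordinates]) simp
    then show ?thesis
      using exhaust_7[of j] by (auto simp: nsphere_to_S6_def)
  qed
  fix b :: "real^7" assume "b \<in> Basis"
  then obtain j where "b = axis j 1"
    by (auto simp: Basis_vec_def)
  then show "continuous_on X (\<lambda>x. nsphere_to_S6 x \<bullet> b)"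
    using * by (simp add: inner_axis)
qed

definition nsphere_points :: "(nat \<Rightarrow> real) set" where "nsphere_points = topspace (nsphere 6)"

lemma nsphere_6': "nsphere 6 = top_of_set nsphere_points"
  by (simp add: nsphere_6 nsphere_points_def)

lemma Brouwer_degree2_homotopic_S6:
  assumes "homotopic_with_canon (\<lambda>_. True) S6 S6 f g"
  shows "Brouwer_degree2 6 (S6_to_nsphere \<circ> f \<circ> nsphere_to_S6) = Brouwer_degree2 6 (S6_to_nsphere \<circ> g \<circ> nsphere_to_S6)"
proof (rule Brouwer_degree2_homotopic)
  have "homotopic_with_canon (\<lambda>_. True) S6 nsphere_points (S6_to_nsphere \<circ> f) (S6_to_nsphere \<circ> g)"
    using assms by (rule homotopic_with_compose_continuous_left)
      (auto simp: continuous_S6_to_nsphere nsphere_points_def S6_to_nsphere_mem)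
  then have "homotopic_with_canon (\<lambda>_. True) nsphere_points nsphere_points (S6_to_nsphere \<circ> f \<circ> nsphere_to_S6) (S6_to_nsphere \<circ> g \<circ> nsphere_to_S6)"
    by (rule homotopic_with_compose_continuous_right) (auto simp: continuous_nsphere_to_S6 nsphere_points_def nsphere_to_S6_mem)
  then show "homotopic_with (\<lambda>x. True) (nsphere 6) (nsphere 6) (S6_to_nsphere \<circ> f \<circ> nsphere_to_S6) (S6_to_nsphere \<circ> g \<circ> nsphere_to_S6)"
    by (simp add: nsphere_6')
qed

text \<open>
  Rotation by the angle \<open>\<pi> t\<close> in the plane of \<open>p x\<close> and \<open>q x\<close>.
\<close>

lemma homotopic_by_rotation:
  fixes a p q :: "real^7 \<Rightarrow> real^7"
  assumes "continuous_on S6 a" "continuous_on S6 p" "continuous_on S6 q"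
    and "\<And>x. x \<in> S6 \<Longrightarrow> a x \<bullet> p x = 0" "\<And>x. x \<in> S6 \<Longrightarrow> a x \<bullet> q x = 0"
    and "\<And>x. x \<in> S6 \<Longrightarrow> p x \<bullet> q x = 0" "\<And>x. x \<in> S6 \<Longrightarrow> q x \<bullet> q x = p x \<bullet> p x"
    and "\<And>x. x \<in> S6 \<Longrightarrow> a x \<bullet> a x + p x \<bullet> p x = 1"
  shows "homotopic_with_canon (\<lambda>_. True) S6 S6 (\<lambda>x. a x + p x) (\<lambda>x. a x - p x)"
proof (subst homotopic_with, simp, intro exI conjI ballI)
  let ?h = "\<lambda>(t, x). a x + cos (pi * t) *\<^sub>R p x + sin (pi * t) *\<^sub>R q x"
  have c: "continuous_on ({0..1} \<times> S6) (\<lambda>z. f (snd z))" if "continuous_on S6 f"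
    for f :: "real^7 \<Rightarrow> real^7"
    by (rule continuous_on_compose2[OF that]) (auto intro: continuous_intros)
  have "continuous_on ({0..1} \<times> S6) ?h"
    unfolding split_beta by (intro continuous_intros c assms)
  moreover have "?h \<in> {0..1} \<times> S6 \<rightarrow> S6"
  proof (clarsimp simp: S6_def norm_eq_1)
    fix t :: real and x :: "real^7"
    assume "x \<bullet> x = 1"
    then have x: "x \<in> S6"
      by (simp add: S6_def norm_eq_1)
    define k l where "k = cos (pi * t)" and "l = sin (pi * t)"
    define v where "v = a x + k *\<^sub>R p x + l *\<^sub>R q x"
    have "v \<bullet> v = a x \<bullet> a x + (k * k + l * l) * (p x \<bullet> p x)"
      using assms(4-7)[OF x] unfolding v_def
      by (simp add: inner_add_left inner_add_right inner_commute distrib_right)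
    also have "k * k + l * l = 1"
      by (simp add: k_def l_def flip: power2_eq_square)
    finally have "v \<bullet> v = 1"
      using assms(8)[OF x] by simp
    then show "(a x + cos (pi * t) *\<^sub>R p x + sin (pi * t) *\<^sub>R q x) \<bullet>
        (a x + cos (pi * t) *\<^sub>R p x + sin (pi * t) *\<^sub>R q x) = 1"
      by (simp add: v_def k_def l_def)
  qed
  ultimately show "continuous_map (prod_topology (top_of_set {0..1}) (top_of_set S6)) (top_of_set S6) ?h"
    by (auto simp: continuous_map_in_subtopology)
qed auto

text \<open>
  Rotating \<open>x\<close> towards \<open>s x\<close> joins the identity to the antipodal map.  The hyperplane orthogonal to \<open>e\<^sub>1\<close> has the complex structure
  \<open>e\<^sub>1 \<times> _\<close>, and rotating in it joins the antipodal map to a reflection.  But the identity has degree 1 and the reflection degree -1.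
\<close>

theorem hairy_ball_S6:
  assumes s: "continuous_on S6 s" "\<And>x. x \<in> S6 \<Longrightarrow> s x \<noteq> 0" "\<And>x. x \<in> S6 \<Longrightarrow> s x \<bullet> x = 0"
  shows False
proof -
  have n: "x \<bullet> x = 1" if "x \<in> S6" for x
    using that by (simp add: S6_def norm_eq_1)
  define r where "r = (\<lambda>x. - x$1 *\<^sub>R e1 + (x - x$1 *\<^sub>R e1))"
  have e1: "e1 $ 1 = 1" "x \<bullet> e1 = x $ 1" "e1 \<bullet> x = x $ 1" for x
    by (simp_all add: e1_def inner_axis inner_axis')
  have "homotopic_with_canon (\<lambda>_. True) S6 S6 (\<lambda>x. 0 + x) (\<lambda>x. 0 - x)"
  proof (rule homotopic_by_rotation)
    show "continuous_on S6 (\<lambda>x. s x /\<^sub>R norm (s x))"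
      using s by (intro continuous_intros) auto
    show "x \<bullet> (s x /\<^sub>R norm (s x)) = 0" if "x \<in> S6" for x
      using s(3)[OF that] by (simp add: inner_commute)
    show "(s x /\<^sub>R norm (s x)) \<bullet> (s x /\<^sub>R norm (s x)) = x \<bullet> x" if "x \<in> S6" for x
      using n[OF that] s(2)[OF that] by (simp add: dot_square_norm power2_eq_square)
  qed (auto intro: continuous_intros n)
  from Brouwer_degree2_homotopic_S6[OF this]
  have 1: "Brouwer_degree2 6 (S6_to_nsphere \<circ> (\<lambda>x. x) \<circ> nsphere_to_S6) = Brouwer_degree2 6 (S6_to_nsphere \<circ> uminus \<circ> nsphere_to_S6)"
    by (simp add: o_def)
  have "homotopic_with_canon (\<lambda>_. True) S6 S6 (\<lambda>x. - x$1 *\<^sub>R e1 + (x - x$1 *\<^sub>R e1)) (\<lambda>x. - x$1 *\<^sub>R e1 - (x - x$1 *\<^sub>R e1))"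
  proof (rule homotopic_by_rotation)
    show "continuous_on S6 (\<lambda>x. cross7 e1 x)"
      by (intro continuous_intros cross7.continuous_on)
    show "cross7 e1 x \<bullet> cross7 e1 x = (x - x$1 *\<^sub>R e1) \<bullet> (x - x$1 *\<^sub>R e1)" for x
      by (simp add: norm_cross7 e1 inner_diff_left inner_diff_right power2_eq_square inner_commute)
    show "(- x$1 *\<^sub>R e1) \<bullet> (- x$1 *\<^sub>R e1) + (x - x$1 *\<^sub>R e1) \<bullet> (x - x$1 *\<^sub>R e1) = 1" if "x \<in> S6" for x
      using n[OF that] by (simp add: e1 inner_diff_left inner_diff_right power2_eq_square inner_commute)
  qed (auto intro!: continuous_intros simp: e1 inner_diff_left inner_diff_right)
  then have "homotopic_with_canon (\<lambda>_. True) S6 S6 r uminus"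
    by (rule homotopic_with_eq) (auto simp: r_def)
  from Brouwer_degree2_homotopic_S6[OF this]
  have 2: "Brouwer_degree2 6 (S6_to_nsphere \<circ> r \<circ> nsphere_to_S6) = Brouwer_degree2 6 (S6_to_nsphere \<circ> uminus \<circ> nsphere_to_S6)" .
  have "Brouwer_degree2 6 (S6_to_nsphere \<circ> (\<lambda>x. x) \<circ> nsphere_to_S6) = Brouwer_degree2 6 id"
    by (rule Brouwer_degree2_eq) (simp add: S6_to_nsphere_mem_to_S6)
  moreover have "Brouwer_degree2 6 (S6_to_nsphere \<circ> r \<circ> nsphere_to_S6) = Brouwer_degree2 6 (\<lambda>x i. if i = 0 then - x i else x i)"
  proof (rule Brouwer_degree2_eq)
    fix x assume x: "x \<in> topspace (nsphere 6)"
    show "(S6_to_nsphere \<circ> r \<circ> nsphere_to_S6) x = (\<lambda>i. if i = 0 then - x i else x i)"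
    proof
      fix i
      show "(S6_to_nsphere \<circ> r \<circ> nsphere_to_S6) x i = (if i = 0 then - x i else x i)"
        using x by (auto simp: nsphere_6 S6_to_nsphere_def r_def nsphere_to_S6_def e1_def axis_def dest!: less_7_cases)
    qed
  qed
  ultimately show False
    using 1 2 Brouwer_degree2_reflection[of 6] by simp
qed

section \<open>The line subbundle of a compatible complex structure\<close>

lemma smooth_map_on_continuous:
  assumes "smooth_map_on S f"
  shows "continuous_on S f"
  unfolding continuous_on_eq_continuous_within
proof
  fix x assume x: "x \<in> S"
  then obtain U F where U: "open U" "x \<in> U" and F: "\<forall>k. Ck_on_open k U F" and eq: "\<forall>y\<in>S \<inter> U. F y = f y"
    using assms unfolding smooth_map_on_def by meson
  have "continuous_on U F"
    using F[rule_format, of 0] by simp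
  then have "isCont F x"
    using U by (simp add: continuous_on_eq_continuous_at)
  then have "(F \<longlongrightarrow> F x) (at x within S)"
    by (auto simp: isCont_def intro: tendsto_within_subset)
  moreover have "eventually (\<lambda>y. F y = f y) (at x within S)"
    unfolding eventually_at_topological using U eq by (intro exI[of _ U]) auto
  moreover have "F x = f x"
    using eq U(2) x by blast
  ultimately show "continuous (at x within S) f"
    by (simp add: continuous_within tendsto_cong)
qed

text \<open>
  The endomorphism \<open>J y\<close> precomposed with the projection to \<open>T\<^sub>yS\<^sup>6\<close>, hence a linear map of \<open>\<real>\<^sup>7\<close>.
\<close>

definition tangential :: "(real^7 \<Rightarrow> real^7 \<Rightarrow> real^7) \<Rightarrow> real^7 \<Rightarrow> real^7 \<Rightarrow> real^7" where
  "tangential J y v = J y (v - (v \<bullet> y) *\<^sub>R y)"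

lemma tangential_eq: "v \<bullet> y = 0 \<Longrightarrow> tangential J y v = J y v"
  by (simp add: tangential_def)

lemma S6_inner: "y \<in> S6 \<longleftrightarrow> y \<bullet> y = 1"
  by (simp add: S6_def norm_eq_1)

lemma tangential_compatible_structure:
  assumes J: "almost_complex_structure J" "omega_compatible J" and y: "y \<in> S6"
  shows "compatible_structure y (tangential J y)"
proof (rule compatible_structure.intro)
  have yy: "y \<bullet> y = 1"
    using y by (simp add: S6_inner)
  then show "y \<bullet> y = 1" .
  have cs: "complex_structure_on_tangent y (J y)"
    using J(1) y by (simp add: almost_complex_structure_def)
  define p where "p = (\<lambda>v. v - (v \<bullet> y) *\<^sub>R y)"
  have p: "p v \<bullet> y = 0" "p (u + v) = p u + p v" "p (r *\<^sub>R v) = r *\<^sub>R p v" for u v r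
    by (simp_all add: p_def inner_diff_left inner_add_left yy algebra_simps)
  have "tangential J y v = J y (p v)" for v
    by (simp add: tangential_def p_def)
  then show "linear (tangential J y)"
    using cs p by (intro linearI)
      (simp_all add: complex_structure_on_tangent_def real_linear_on_tangent_def tangent_S6_def)
  have t: "J y v \<bullet> y = 0" "J y (J y v) = - v" if "v \<bullet> y = 0" for v
    using cs that by (simp_all add: complex_structure_on_tangent_def tangent_S6_def)
  show "tangential J y v \<bullet> y = 0" if "v \<bullet> y = 0" for v
    using t that by (simp add: tangential_eq)
  show "tangential J y (tangential J y v) = - v" if "v \<bullet> y = 0" for v
    using t that by (simp add: tangential_eq)
  show "cross7 y (tangential J y u) \<bullet> tangential J y v = cross7 y u \<bullet> v"
    if "u \<bullet> y = 0" "v \<bullet> y = 0" for u v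
  proof -
    have "J_can y (J y u) \<bullet> J y v = J_can y u \<bullet> v"
      using J(2) y that by (simp add: omega_compatible_def omega_def tangent_S6_def)
    then show ?thesis
      using that t by (simp add: tangential_eq J_can_eq_cross7[OF y])
  qed
qed

lemma continuous_tangential:
  assumes J: "almost_complex_structure J" and ab: "continuous_on X a" "continuous_on X b"
    and a: "\<And>x. x \<in> X \<Longrightarrow> a x \<in> S6"
  shows "continuous_on X (\<lambda>x. tangential J (a x) (b x))"
proof -
  have "continuous_on TS6 (\<lambda>(y, v). J y v)"
    using J by (intro smooth_map_on_continuous) (simp add: almost_complex_structure_def)
  then have "continuous_on X (\<lambda>x. (\<lambda>(y, v). J y v) (a x, b x - (b x \<bullet> a x) *\<^sub>R a x))"
  proof (rule continuous_on_compose2)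
    show "continuous_on X (\<lambda>x. (a x, b x - (b x \<bullet> a x) *\<^sub>R a x))"
      by (intro continuous_intros ab)
    show "(\<lambda>x. (a x, b x - (b x \<bullet> a x) *\<^sub>R a x)) ` X \<subseteq> TS6"
      using a by (auto simp: TS6_def tangent_S6_def S6_inner inner_diff_left)
  qed
  then show ?thesis
    by (simp add: tangential_def)
qed

definition minority_set :: "(real^7 \<Rightarrow> real^7 \<Rightarrow> real^7) \<Rightarrow> ((real^7) \<times> (real^7)) set" where
  "minority_set J = {(y, u). y \<in> S6 \<and> compatible_structure.minority y (tangential J y) u}"

text \<open>
  For a fixed sign the conditions are weak inequalities between continuous functions of \<open>(y, u)\<close>.  The quantifier over the vectors
  orthogonal to \<open>y\<close>, \<open>u\<close> and \<open>y \<times> u\<close> ranges over a set that varies, so it is replaced by one over all vectors \<open>v\<close> and their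
  projections \<open>N p v\<close>.
\<close>

lemma compact_minority_set:
  assumes J: "almost_complex_structure J" "omega_compatible J"
  shows "compact (minority_set J)"
proof -
  define T where "T = {p :: (real^7) \<times> (real^7). fst p \<in> S6 \<and> snd p \<bullet> fst p = 0 \<and> snd p \<bullet> snd p = 1}"
  define q where "q = (\<lambda>(p :: (real^7) \<times> (real^7)) v. cross7 (fst p) v \<bullet> tangential J (fst p) v
      - tangential J (fst p) (cross7 (fst p) v) \<bullet> v)"
  define N where "N = (\<lambda>(p :: (real^7) \<times> (real^7)) v. v - (v \<bullet> fst p) *\<^sub>R fst p - (v \<bullet> snd p) *\<^sub>R snd p
      - (v \<bullet> cross7 (fst p) (snd p)) *\<^sub>R cross7 (fst p) (snd p))"
  define E where "E = (\<lambda>\<sigma>. {p \<in> T. norm (tangential J (fst p) (snd p) -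
        (cross7 (fst p) (snd p) \<bullet> tangential J (fst p) (snd p)) *\<^sub>R cross7 (fst p) (snd p)) \<le> 0}
     \<inter> {p \<in> T. \<sigma> * q p (snd p) \<le> - 2} \<inter> (\<Inter>v. {p \<in> T. 2 * (N p v \<bullet> N p v) \<le> \<sigma> * q p (N p v)}))"
  have T_eq: "T = (S6 \<times> sphere 0 1) \<inter> {p. snd p \<bullet> fst p = 0}"
    by (auto simp: T_def norm_eq_1)
  have "compact T"
    unfolding T_eq S6_def
    by (intro compact_Int_closed compact_Times closed_Collect_eq continuous_intros) auto
  have "closed T"
    using \<open>compact T\<close> by (rule compact_imp_closed)
  have cJ: "continuous_on T (\<lambda>p. tangential J (fst p) (b p))" if "continuous_on T b" for b
    by (rule continuous_tangential[OF J(1) _ that]) (auto intro: continuous_intros simp: T_def)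
  have cN: "continuous_on T (\<lambda>p. N p v)" for v
    unfolding N_def by (intro continuous_intros cross7.continuous_on)
  have cQ: "continuous_on T (\<lambda>p. q p (b p))" if "continuous_on T b" for b
    unfolding q_def by (intro continuous_intros cross7.continuous_on cJ that)
  have "closed (E \<sigma>)" for \<sigma>
    unfolding E_def
    by (intro closed_Int closed_INT ballI continuous_on_closed_Collect_le \<open>closed T\<close>
        continuous_intros cross7.continuous_on cJ cQ cN)
  then have "compact (T \<inter> (E 1 \<union> E (- 1)))"
    using \<open>compact T\<close> by (intro compact_Int_closed closed_Un)
  moreover have "minority_set J = T \<inter> (E 1 \<union> E (- 1))"
  proof (rule Set.set_eqI)
    fix p :: "(real^7) \<times> (real^7)"
    obtain y u where p: "p = (y, u)"
      by (cases p)
    show "p \<in> minority_set J \<longleftrightarrow> p \<in> T \<inter> (E 1 \<union> E (- 1))"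
    proof (cases "y \<in> S6 \<and> u \<bullet> y = 0 \<and> u \<bullet> u = 1")
      case True
      interpret compatible_structure y "tangential J y"
        using tangential_compatible_structure[OF J] True by blast
      have pT: "p \<in> T"
        using True by (simp add: T_def p)
      have qp: "q p v = Q v" for v
        by (simp add: q_def p Q_def)
      have Kuu: "cross7 y u \<bullet> cross7 y u = 1" "y \<bullet> y = 1"
        using K_isometry[of u u] True unit by auto
      have N: "N p v \<bullet> y = 0 \<and> uorth (N p v) u" for v
        using True Kuu by (simp add: N_def p uorth_def inner_diff_left inner_commute[of y u])
      have N_id: "N p v = v" if "v \<bullet> y = 0 \<and> uorth v u" for v
        using that by (simp add: N_def p uorth_def)
      have all: "(\<forall>v. v \<bullet> y = 0 \<and> uorth v u \<longrightarrow> 2 * (v \<bullet> v) \<le> \<sigma> * Q v) \<longleftrightarrow>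
          (\<forall>v. 2 * (N p v \<bullet> N p v) \<le> \<sigma> * Q (N p v))" for \<sigma>
        using N N_id by metis
      have mem_E: "p \<in> E \<sigma> \<longleftrightarrow> tangential J y u = (K u \<bullet> tangential J y u) *\<^sub>R K u \<and> \<sigma> * Q u \<le> - 2 \<and>
          (\<forall>v. 2 * (N p v \<bullet> N p v) \<le> \<sigma> * Q (N p v))" for \<sigma>
        unfolding E_def by (simp only: Int_iff INT_iff mem_Collect_eq pT qp) (simp add: p)
      have "p \<in> minority_set J \<longleftrightarrow> minority u"
        using True by (simp add: minority_set_def p)
      also have "\<dots> \<longleftrightarrow> p \<in> E 1 \<or> p \<in> E (- 1)"
        unfolding minority_def all mem_E using True by blast
      finally show ?thesis
        using pT by blast
    next
      case False
      have "p \<notin> T"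
        using False by (simp add: T_def p)
      moreover have "p \<notin> minority_set J"
      proof
        assume "p \<in> minority_set J"
        then have y: "y \<in> S6" and m: "compatible_structure.minority y (tangential J y) u"
          by (simp_all add: minority_set_def p)
        from m have "u \<bullet> y = 0 \<and> u \<bullet> u = 1"
          unfolding compatible_structure.minority_def[OF tangential_compatible_structure[OF J y]] by blast
        then show False
          using False y by blast
      qed
      ultimately show ?thesis
        by blast
    qed
  qed
  ultimately show ?thesis
    by simp
qed

lemma minority_line_bundle:
  assumes J: "almost_complex_structure J" "integrable_acs J" "omega_compatible J"
  shows "line_bundle cross7 (minority_set J)"
proof (rule line_bundle.intro)
  note C = tangential_compatible_structure[OF J(1,3)]
  show "bounded_bilinear cross7"
    by (rule bounded_bilinear_cross7)
  show "compact (minority_set J)"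
    by (rule compact_minority_set[OF J(1,3)])
  show "\<exists>u. (y, u) \<in> minority_set J" if "y \<in> sphere 0 1" for y
  proof -
    have y: "y \<in> S6"
      using that by (simp add: S6_def)
    interpret compatible_structure y "tangential J y"
      by (rule C[OF y])
    have "\<exists>u. minority u"
    proof (rule minority_exists)
      fix u v w :: "real^7" assume t: "u \<bullet> y = 0" "v \<bullet> y = 0" "w \<bullet> y = 0"
      have "cross7 u v \<bullet> w = cross7 (J y u) (J y v) \<bullet> w + cross7 (J y u) v \<bullet> J y w + cross7 u (J y v) \<bullet> J y w"
      proof (rule integrable_type_identity[OF J(2) _ _ y t])
        fix y v :: "real^7" assume "y \<in> S6" "v \<bullet> y = 0"
        then show "J y v \<bullet> y = 0"
          using compatible_structure.J_tangent[OF C] by (metis tangential_eq)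
      next
        fix y u v :: "real^7" assume "y \<in> S6" "u \<bullet> y = 0" "v \<bullet> y = 0"
        then show "cross7 y (J y u) \<bullet> J y v = cross7 y u \<bullet> v"
          using compatible_structure.compat[OF C] by (metis tangential_eq)
      qed
      then show "cross7 u v \<bullet> w = cross7 (tangential J y u) (tangential J y v) \<bullet> w +
          cross7 (tangential J y u) v \<bullet> tangential J y w + cross7 u (tangential J y v) \<bullet> tangential J y w"
        using t by (simp add: tangential_eq)
    qed
    then show ?thesis
      using y by (simp add: minority_set_def)
  qed
  fix y u assume yu: "(y, u) \<in> minority_set J"
  then have y: "y \<in> S6"
    by (simp add: minority_set_def)
  interpret compatible_structure y "tangential J y"
    by (rule C[OF y])
  have u: "minority u" "u \<bullet> y = 0" "u \<bullet> u = 1"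
    using yu by (simp_all add: minority_set_def minority_def)
  show "y \<in> sphere 0 1"
    using y by (simp add: S6_def)
  show "u \<bullet> u = 1" "cross7 y u \<bullet> cross7 y u = 1" "u \<bullet> cross7 y u = 0" "cross7 y (cross7 y u) = - u"
    using u K_isometry[of u u] K_K[of u] by simp_all
  show "v = (v \<bullet> u) *\<^sub>R u + (v \<bullet> cross7 y u) *\<^sub>R cross7 y u" if "(y, v) \<in> minority_set J" for v
    using minority_line[OF u(1)] that by (simp add: minority_set_def)
qed

theorem theorem1p2:
  shows "\<not> (\<exists>J. almost_complex_structure J \<and> integrable_acs J \<and> omega_compatible J)"
proof
  assume "\<exists>J. almost_complex_structure J \<and> integrable_acs J \<and> omega_compatible J"
  then obtain J where J: "almost_complex_structure J" "integrable_acs J" "omega_compatible J"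
    by blast
  interpret line_bundle cross7 "minority_set J"
    by (rule minority_line_bundle[OF J])
  obtain s where s: "continuous_on (sphere 0 1) s" "\<And>y. y \<in> sphere 0 1 \<Longrightarrow> s y \<noteq> 0"
    "\<And>y. y \<in> sphere 0 1 \<Longrightarrow> P y (s y) = s y"
    using section_exists by auto
  show False
  proof (rule hairy_ball_S6)
    show "continuous_on S6 s" "\<And>y. y \<in> S6 \<Longrightarrow> s y \<noteq> 0"
      using s by (auto simp: S6_def)
    show "s y \<bullet> y = 0" if "y \<in> S6" for y
    proof -
      have y: "y \<in> sphere 0 1"
        using that by (simp add: S6_def)
      obtain u where u: "(y, u) \<in> minority_set J"
        using nonempty[OF y] by blast
      then have "u \<bullet> y = 0"
        using compatible_structure.minority_def[OF tangential_compatible_structure[OF J(1,3) that]]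
        by (simp add: minority_set_def)
      then have "P y (s y) \<bullet> y = 0"
        by (simp add: P_eq[OF u] inner_add_left)
      then show ?thesis
        by (simp add: s(3)[OF y])
    qed
  qed
qed

end
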